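(* Let $K$ be a field, let $n,t,p,d$ be integers with $2\le t\le n$, $n=(t+1)p+d$, $p\ge 0$ and $0\le d<t+1$, let $R=K[x_1,\dots,x_n]$, and let $I_t(C_n)\subset R$ be the path ideal of the cycle $C_n$. Let $i,j$ be integers with $i\le j<n$. If $\beta_{i,j}(R/I_t(C_n))\neq 0$, then all of the following hold: (1) $j\le it$; (2) $j-i\le (t-1)p$; (3) if $d=0$, then $i<2p$; (4) if $d\neq 0$, then $i\le 2p+1$.
   Context: The path ideal $I_t(C_n)$ is the ideal of $R=K[x_1,\dots,x_n]$ generated by the monomials $x_{i}x_{i+1}\cdots x_{i+t-1}$, $1\le i\le n$, with indices taken modulo $n$ in $\{1,\dots,n\}$ (one monomial for each path on $t$ vertices in the cycle $C_n$ with edges $\{x_1,x_2\},\dots,\{x_{n-1},x_n\},\{x_n,x_1\}$). $R$ is standard graded, and $\beta_{i,j}(R/I)$ denotes the number of copies of $R(-j)$ in homological degree $i$ of the minimal graded free resolution of $R/I$ (with $R$ itself in homological degree $0$). *)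

theory Defs
  imports "HOL-Library.Poly_Mapping" "Jordan_Normal_Form.Matrix_Kernel"
begin

text \<open>Multivariate polynomials over the field \<open>'k\<close> in the variables \<open>x\<^sub>0, x\<^sub>1, \<dots>\<close>: finitely
  supported maps from exponent vectors to coefficients, with convolution as multiplication.\<close>

type_synonym 'k mpoly = "(nat \<Rightarrow>\<^sub>0 nat) \<Rightarrow>\<^sub>0 'k"

definition Var :: "nat \<Rightarrow> 'k::field mpoly" where
  "Var v = Poly_Mapping.single (Poly_Mapping.single v 1) 1"

text \<open>The ring \<open>R = K[x\<^sub>1, \<dots>, x\<^sub>n]\<close>, as a subring of the type \<open>'k mpoly\<close>.\<close>

definition poly_ring :: "nat \<Rightarrow> 'k::field mpoly set" where
  "poly_ring n = {f. \<forall>m \<in> Poly_Mapping.keys f. Poly_Mapping.keys m \<subseteq> {1..n}}"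

definition mono_deg :: "(nat \<Rightarrow>\<^sub>0 nat) \<Rightarrow> nat" where
  "mono_deg m = (\<Sum>v \<in> Poly_Mapping.keys m. Poly_Mapping.lookup m v)"

definition ideal_generated :: "nat \<Rightarrow> 'k::field mpoly set \<Rightarrow> 'k mpoly set" where
  "ideal_generated n G =
     {\<Sum>g\<in>A. c g * g | A c. finite A \<and> A \<subseteq> G \<and> (\<forall>g\<in>A. c g \<in> poly_ring n)}"

text \<open>The representative in \<open>{1..n}\<close> of \<open>k \<ge> 1\<close> modulo \<open>n\<close>.\<close>

definition cyc :: "nat \<Rightarrow> nat \<Rightarrow> nat" where
  "cyc n k = Suc ((k - 1) mod n)"

definition path_ideal_cycle :: "nat \<Rightarrow> nat \<Rightarrow> 'k::field mpoly set" where
  "path_ideal_cycle n t =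
     ideal_generated n ((\<lambda>i. \<Prod>k<t. Var (cyc n (i + k))) ` {1..n})"

text \<open>A finitely generated graded free module \<open>R(-b\<^sub>0) \<oplus> \<dots> \<oplus> R(-b\<^bsub>r-1\<^esub>)\<close> is given by its list of
  shifts \<open>[b\<^sub>0, \<dots>, b\<^bsub>r-1\<^esub>]\<close>. Its underlying module is \<open>R\<^sup>r\<close>, with the \<open>k\<close>-th basis vector placed in
  degree \<open>b\<^sub>k\<close>.\<close>

definition free_module :: "nat \<Rightarrow> nat \<Rightarrow> 'k::field mpoly vec set" where
  "free_module n r = {v \<in> carrier_vec r. \<forall>k<r. v $ k \<in> poly_ring n}"

text \<open>\<open>A\<close> is the matrix of a degree-preserving \<open>R\<close>-linear map from the module with shifts \<open>bs\<close> to the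
  module with shifts \<open>as\<close>: its \<open>(r,c)\<close> entry is homogeneous of degree \<open>b\<^sub>c - a\<^sub>r\<close> (in particular \<open>0\<close>
  if this is negative).\<close>

definition graded_map :: "nat \<Rightarrow> int list \<Rightarrow> int list \<Rightarrow> 'k::field mpoly mat \<Rightarrow> bool" where
  "graded_map n bs as A \<longleftrightarrow>
     A \<in> carrier_mat (length as) (length bs) \<and>
     (\<forall>r < length as. \<forall>c < length bs.
        A $$ (r, c) \<in> poly_ring n \<and>
        (\<forall>m \<in> Poly_Mapping.keys (A $$ (r, c)). int (mono_deg m) = bs ! c - as ! r))"

definition map_image :: "nat \<Rightarrow> 'k::field mpoly mat \<Rightarrow> 'k mpoly vec set" where
  "map_image n A = (\<lambda>v. A *\<^sub>v v) ` free_module n (dim_col A)"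

definition map_kernel :: "nat \<Rightarrow> 'k::field mpoly mat \<Rightarrow> 'k mpoly vec set" where
  "map_kernel n A = mat_kernel A \<inter> free_module n (dim_col A)"

text \<open>The entries of \<open>A\<close> lie in the maximal ideal \<open>(x\<^sub>1, \<dots>, x\<^sub>n)\<close>.\<close>

definition minimal_map :: "'k::field mpoly mat \<Rightarrow> bool" where
  "minimal_map A \<longleftrightarrow>
     (\<forall>r < dim_row A. \<forall>c < dim_col A. Poly_Mapping.lookup (A $$ (r, c)) 0 = 0)"

text \<open>The minimal graded free resolution
  \<open>\<dots> \<longrightarrow> F\<^sub>2 \<longrightarrow> F\<^sub>1 \<longrightarrow> F\<^sub>0 = R \<longrightarrow> R/I \<longrightarrow> 0\<close> for a proper homogeneous ideal \<open>I\<close> of \<open>R\<close>. Here \<open>S i\<close> is the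
  list of shifts of \<open>F\<^sub>i\<close> and \<open>D i\<close> is the matrix of \<open>F\<^bsub>i+1\<^esub> \<longrightarrow> F\<^sub>i\<close>; exactness at \<open>F\<^sub>0\<close> says that the
  image of \<open>D 0\<close> is \<open>I\<close>.\<close>

definition minimal_graded_free_resolution ::
  "nat \<Rightarrow> 'k::field mpoly set \<Rightarrow> (nat \<Rightarrow> int list) \<Rightarrow> (nat \<Rightarrow> 'k mpoly mat) \<Rightarrow> bool" where
  "minimal_graded_free_resolution n I S D \<longleftrightarrow>
     S 0 = [0] \<and>
     (\<forall>i. graded_map n (S (Suc i)) (S i) (D i)) \<and>
     (\<lambda>v. v $ 0) ` map_image n (D 0) = I \<and>
     (\<forall>i. map_kernel n (D i) = map_image n (D (Suc i))) \<and>
     (\<forall>i. minimal_map (D i))"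

text \<open>The number of summands \<open>R(-j)\<close> in \<open>F\<^sub>i\<close>. Minimal graded free resolutions are unique up to
  isomorphism, so this depends only on \<open>R/I\<close>.\<close>

definition graded_betti :: "(nat \<Rightarrow> int list) \<Rightarrow> nat \<Rightarrow> int \<Rightarrow> nat" where
  "graded_betti S i j = count_list (S i) j"

end

theory Submission
  imports Defs
begin

text \<open>The bounds are combinatorial facts about which multidegrees can carry homology of the Koszul complex
of \<open>R/I\<close>, where \<open>I = I\<^sub>t(C\<^sub>n)\<close>.

A generator of degree \<open>j\<close> in step \<open>i\<close> of a minimal resolution \<open>F\<close> yields a nonzero class of degree \<open>j\<close>
in \<open>H\<^sub>i\<close> of the Koszul complex of \<open>R/I\<close>. Computing \<open>Tor\<^sub>i(R/I, K)\<close> from either factor shows this, and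
the argument is a staircase in the double complex \<open>F \<otimes> \<Lambda>\<close>, where \<open>\<Lambda>\<close> is the Koszul complex of
\<open>x\<^sub>1, \<dots>, x\<^sub>n\<close>: minimality of \<open>F\<close> starts the staircase, exactness of \<open>\<Lambda>\<close> in positive degrees continues
it, and exactness of \<open>F\<close> shows that a boundary at the far end would trace back to a boundary at the
start (\<open>survives_step\<close>, \<open>generator_survives\<close>). Since \<open>I\<close> is a monomial ideal, the Koszul complex of
\<open>R/I\<close> splits into strands indexed by exponent vectors \<open>e\<close>, so some strand with \<open>|e| = j\<close> has homology
in degree \<open>i\<close> (\<open>betti_strand\<close>).

The strand at \<open>e\<close> is a complex of functions on sets of variables. It is a cone, hence acyclic, when
some variable occurs in \<open>e\<close> with exponent at least 2 (\<open>nonacyclic_squarefree\<close>), so \<open>e\<close> is the indicator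
vector of a set \<open>W\<close> of \<open>j\<close> vertices, and the strand computes the homology of the simplicial complex of
subsets of \<open>W\<close> that contain no path on \<open>t\<close> vertices. As \<open>j < n\<close>, the set \<open>W\<close> misses a vertex, and cutting
the cycle there places \<open>W\<close> on a line (\<open>cut_cycle\<close>).

On a line, look at the last vertex \<open>m\<close> of \<open>W\<close> (\<open>line_nonacyclic_bounds\<close>). If \<open>W\<close> does not contain the
path ending at \<open>m\<close>, the complex is a cone over \<open>m\<close>. If \<open>W\<close> contains that path and also the vertex
\<open>m - t\<close> before it, the link of \<open>m - t\<close> is a cone over \<open>m\<close>, so \<open>m - t\<close> can be deleted at the cost of one
homological degree. What is left is an isolated path of \<open>t\<close> vertices, the boundary of a simplex, which
splits off at the cost of one more homological degree. Hence homology forces \<open>W\<close> to be made of \<open>b\<close>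
blocks, of which \<open>a\<close> have \<open>t + 1\<close> vertices and \<open>b - a\<close> have \<open>t\<close> vertices, with
\<open>i = b + a\<close> and \<open>j = b t + a\<close>. A block of \<open>t\<close> vertices is preceded by a vertex outside \<open>W\<close>, so every
block accounts for \<open>t + 1\<close> of the \<open>n\<close> vertices of the cycle; thus \<open>b (t + 1) \<le> n\<close> and \<open>b \<le> p\<close>. The four
claims are arithmetic in \<open>a \<le> b \<le> p\<close>; when \<open>d = 0\<close>, the value \<open>i = 2 p\<close> would need \<open>a = b = p\<close> and so
\<open>j = n\<close>.\<close>

section \<open>Strands of Koszul complexes\<close>

definition koszul_sign :: "nat \<Rightarrow> nat set \<Rightarrow> 'a::comm_ring_1" where
  "koszul_sign v A = (-1) ^ card {a \<in> A. a < v}"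

lemma koszul_sign_square: "koszul_sign v A * (koszul_sign v A * x) = (x :: 'a::comm_ring_1)"
proof -
  have "koszul_sign v A * koszul_sign v A = (1 :: 'a)"
    by (simp add: koszul_sign_def flip: power_mult_distrib)
  then show ?thesis
    by (simp flip: mult.assoc)
qed

text \<open>Removing two basis vectors from an exterior monomial in the two possible orders gives opposite signs.\<close>

lemma koszul_sign_swap:
  assumes "finite A" "v \<notin> A" "w \<notin> A" "v \<noteq> w"
  shows "koszul_sign v A * koszul_sign w (insert v A) =
    - (koszul_sign w A * koszul_sign v (insert w A) :: 'a::comm_ring_1)"
proof -
  have *: "koszul_sign v A * koszul_sign w (insert v A) =
      - (koszul_sign w A * koszul_sign v (insert w A) :: 'a)"
    if "v < w" "v \<notin> A" for v w
  proof -
    have "{a \<in> insert v A. a < w} = insert v {a \<in> A. a < w}"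
      and "{a \<in> insert w A. a < v} = {a \<in> A. a < v}"
      using that by auto
    then show ?thesis
      using that assms(1) by (simp add: koszul_sign_def)
  qed
  show ?thesis
    using *[of v w] *[of w v] assms by (cases v w rule: linorder_cases) auto
qed

text \<open>The strand at a squarefree exponent vector with support \<open>W\<close> has one basis element \<open>x\<^bsup>W - A\<^esup> e\<^sub>A\<close> for each
  \<open>A \<subseteq> W\<close>; \<open>strand_d W\<close> is the Koszul differential in these coordinates.\<close>

definition strand_d :: "nat set \<Rightarrow> (nat set \<Rightarrow> 'a::comm_ring_1) \<Rightarrow> nat set \<Rightarrow> 'a" where
  "strand_d W f A = (\<Sum>v\<in>W - A. koszul_sign v A * f (insert v A))"

text \<open>Working modulo a monomial ideal keeps only those \<open>A\<close> for which \<open>x\<^bsup>W - A\<^esup>\<close> is outside the ideal. They form a family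
  \<open>U\<close> that is closed under enlarging \<open>A\<close> within \<open>W\<close>, so \<open>strand_d W f\<close> on \<open>U\<close> depends only on the values of \<open>f\<close>
  on \<open>U\<close>, and the values elsewhere can be left arbitrary instead of being forced to \<open>0\<close>. The complements \<open>W - A\<close>
  are the faces of a simplicial complex on \<open>W\<close>. The first argument only fixes the coefficient ring.\<close>

definition acyclic_at :: "'a::comm_ring_1 itself \<Rightarrow> nat set \<Rightarrow> nat set set \<Rightarrow> nat \<Rightarrow> bool" where
  "acyclic_at T W U i \<longleftrightarrow>
     (\<forall>f :: nat set \<Rightarrow> 'a. (\<forall>A\<in>U. Suc (card A) = i \<longrightarrow> strand_d W f A = 0) \<longrightarrow>
        (\<exists>g. \<forall>A\<in>U. card A = i \<longrightarrow> strand_d W g A = f A))"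

lemma strand_d_cong:
  "(\<And>v. v \<in> W - A \<Longrightarrow> f (insert v A) = g (insert v A)) \<Longrightarrow> strand_d W f A = strand_d W g A"
  by (auto simp: strand_d_def intro!: sum.cong)

text \<open>The next two lemmas split the differential according to whether \<open>v\<close> lies in the index set. In the second
  one, the twist by \<open>koszul_sign v\<close> makes the part indexed by sets containing \<open>v\<close> a shifted copy of the complex
  on \<open>W - {v}\<close>.\<close>

lemma strand_d_without:
  assumes "finite W" "v \<in> W" "v \<notin> A"
  shows "strand_d W f A = koszul_sign v A * f (insert v A) + strand_d (W - {v}) f A"
proof -
  have "W - A = insert v (W - {v} - A)"
    using assms by auto
  then show ?thesis
    using assms by (simp add: strand_d_def)
qed

lemma strand_d_insert:
  assumes "finite W" "v \<in> W" "v \<notin> A" "A \<subseteq> W"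
  shows "koszul_sign v A * strand_d W f (insert v A) =
    - strand_d (W - {v}) (\<lambda>B. koszul_sign v B * f (insert v B)) A"
proof -
  have fin: "finite A"
    using assms finite_subset by blast
  have "koszul_sign v A * (koszul_sign w (insert v A) * f (insert w (insert v A))) =
      - (koszul_sign w A * (koszul_sign v (insert w A) * f (insert v (insert w A))))"
    if "w \<in> W - insert v A" for w
  proof -
    have "koszul_sign v A * koszul_sign w (insert v A) =
        - (koszul_sign w A * koszul_sign v (insert w A) :: 'a)"
      using that assms by (intro koszul_sign_swap fin) auto
    then show ?thesis
      by (simp add: insert_commute flip: mult.assoc)
  qed
  moreover have "W - {v} - A = W - insert v A"
    by auto
  ultimately show ?thesis
    by (auto simp: strand_d_def sum_distrib_left simp flip: sum_negf intro!: sum.cong)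
qed

text \<open>The chain with part \<open>g0\<close> on sets avoiding \<open>v\<close> and twisted part \<open>g1\<close> on sets containing \<open>v\<close>: the inverse of the
  splitting above.\<close>

definition glue :: "nat \<Rightarrow> (nat set \<Rightarrow> 'a::comm_ring_1) \<Rightarrow> (nat set \<Rightarrow> 'a) \<Rightarrow> nat set \<Rightarrow> 'a" where
  "glue v g0 g1 A = (if v \<in> A then koszul_sign v (A - {v}) * g1 (A - {v}) else g0 A)"

lemma strand_d_glue_without:
  assumes "finite W" "v \<in> W" "v \<notin> A"
  shows "strand_d W (glue v g0 g1) A = g1 A + strand_d (W - {v}) g0 A"
proof -
  have "strand_d (W - {v}) (glue v g0 g1) A = strand_d (W - {v}) g0 A"
    by (rule strand_d_cong) (use assms in \<open>auto simp: glue_def\<close>)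
  then show ?thesis
    using assms by (subst strand_d_without[of _ v]) (auto simp: glue_def koszul_sign_square)
qed

lemma strand_d_glue_insert:
  assumes "finite W" "v \<in> W" "v \<notin> A" "A \<subseteq> W"
  shows "koszul_sign v A * strand_d W (glue v g0 g1) (insert v A) = - strand_d (W - {v}) g1 A"
proof -
  have "strand_d (W - {v}) (\<lambda>B. koszul_sign v B * glue v g0 g1 (insert v B)) A = strand_d (W - {v}) g1 A"
    by (rule strand_d_cong) (use assms in \<open>auto simp: glue_def koszul_sign_square\<close>)
  then show ?thesis
    using strand_d_insert[OF assms] by metis
qed

lemma koszul_sign_cancel:
  "koszul_sign v A * x = koszul_sign v A * y \<Longrightarrow> x = (y :: 'a::comm_ring_1)"
  by (metis koszul_sign_square)

text \<open>In terms of the faces \<open>W - A\<close>, these are the faces that avoid \<open>v\<close> and the faces that contain \<open>v\<close>, the latter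
  with \<open>v\<close> removed. Both are again indexed by complements, now inside \<open>W - {v}\<close>.\<close>

definition deletion :: "nat \<Rightarrow> nat set set \<Rightarrow> nat set set" where
  "deletion v U = {A. v \<notin> A \<and> insert v A \<in> U}"

definition link :: "nat \<Rightarrow> nat set set \<Rightarrow> nat set set" where
  "link v U = {A \<in> U. v \<notin> A}"

text \<open>If membership in \<open>U\<close> does not depend on \<open>v\<close>, then moving \<open>v\<close> into the index set is a contracting homotopy.\<close>

lemma acyclic_cone:
  assumes W: "finite W" "v \<in> W" "U \<subseteq> Pow W"
    and cone: "\<And>A. v \<notin> A \<Longrightarrow> insert v A \<in> U \<longleftrightarrow> A \<in> U"
  shows "acyclic_at T W U i"
  unfolding acyclic_at_def
proof (intro allI impI)
  fix f :: "nat set \<Rightarrow> 'a"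
  assume f: "\<forall>A\<in>U. Suc (card A) = i \<longrightarrow> strand_d W f A = 0"
  have "strand_d W (glue v (\<lambda>_. 0) f) A = f A" if A: "A \<in> U" "card A = i" for A
  proof (cases "v \<in> A")
    case False
    then show ?thesis
      using W A by (subst strand_d_glue_without) (auto simp: strand_d_def)
  next
    case True
    then obtain B where B: "A = insert v B" "v \<notin> B"
      by (meson mk_disjoint_insert)
    have BU: "B \<in> U"
      using A B cone by simp
    then have "B \<subseteq> W" "finite B"
      using W finite_subset by blast+
    note BU = BU this
    have "strand_d W f B = 0"
      using f A B BU by auto
    then have "strand_d (W - {v}) f B = - (koszul_sign v B * f A)"
      using strand_d_without[of W v B f] W B by (simp add: eq_neg_iff_add_eq_0 add.commute)
    then have "koszul_sign v B * strand_d W (glue v (\<lambda>_. 0) f) A = koszul_sign v B * f A"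
      using W B BU by (simp add: strand_d_glue_insert)
    then show ?thesis
      by (rule koszul_sign_cancel)
  qed
  then show "\<exists>g. \<forall>A\<in>U. card A = i \<longrightarrow> strand_d W g A = f A"
    by blast
qed

text \<open>The strand is an extension of the shifted complex of the deletion by the complex of the link, so
  acyclicity passes from these two to the strand. The proof lifts a cycle in two steps: its part containing \<open>v\<close>
  bounds in the deletion, and the correction turns the part avoiding \<open>v\<close> into a cycle of the link.\<close>

lemma acyclic_link_deletion:
  assumes W: "finite W" "v \<in> W" "U \<subseteq> Pow W"
    and up: "link v U \<subseteq> deletion v U"
    and lnk: "acyclic_at T (W - {v}) (link v U) i"
    and del: "i = 0 \<or> acyclic_at T (W - {v}) (deletion v U) (i - 1)"
  shows "acyclic_at T W U i"
  unfolding acyclic_at_def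
proof (intro allI impI)
  fix f :: "nat set \<Rightarrow> 'a"
  assume f: "\<forall>A\<in>U. Suc (card A) = i \<longrightarrow> strand_d W f A = 0"
  define f1 where "f1 = (\<lambda>A. koszul_sign v A * f (insert v A))"
  have fin: "finite A" if "A \<in> deletion v U" for A
    using that W unfolding deletion_def by (auto intro: finite_subset[of _ W])
  obtain g1 where g1: "strand_d (W - {v}) g1 A = f1 A" if "A \<in> deletion v U" "Suc (card A) = i" for A
  proof (cases "i = 0")
    case True
    then show ?thesis
      using that by simp
  next
    case False
    have "strand_d (W - {v}) f1 A = 0" if A: "A \<in> deletion v U" "Suc (card A) = i - 1" for A
    proof -
      have "strand_d W f (insert v A) = 0"
        using A f fin[OF A(1)] by (auto simp: deletion_def)
      then show ?thesis
        using strand_d_insert[of W v A f] A W by (auto simp: deletion_def f1_def)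
    qed
    then show ?thesis
      using del False that unfolding acyclic_at_def by (metis Suc_diff_1 diff_Suc_1 neq0_conv)
  qed
  \<comment> \<open>The link needs a cycle; \<open>f\<close> itself is one only up to \<open>f1\<close>, which \<open>g1\<close> bounds.\<close>
  have "strand_d (W - {v}) (\<lambda>A. f A + g1 A) A = 0" if A: "A \<in> link v U" "Suc (card A) = i" for A
  proof -
    have "strand_d (W - {v}) (\<lambda>A. f A + g1 A) A = strand_d (W - {v}) f A + strand_d (W - {v}) g1 A"
      by (simp add: strand_d_def distrib_left sum.distrib)
    also have "\<dots> = strand_d (W - {v}) f A + f1 A"
      using g1 A up by auto
    also have "\<dots> = strand_d W f A"
      using strand_d_without[of W v A f] A W by (auto simp: link_def f1_def)
    also have "\<dots> = 0"
      using f A by (auto simp: link_def)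
    finally show ?thesis .
  qed
  then obtain g0 where g0: "strand_d (W - {v}) g0 A = f A + g1 A" if "A \<in> link v U" "card A = i" for A
    using lnk[unfolded acyclic_at_def, THEN spec, of "\<lambda>A. f A + g1 A"] by blast
  define g where "g = glue v g0 (\<lambda>A. - g1 A)"
  have "strand_d W g A = f A" if A: "A \<in> U" "card A = i" for A
  proof (cases "v \<in> A")
    case False
    then show ?thesis
      using W A g0[of A] unfolding g_def by (subst strand_d_glue_without) (auto simp: link_def)
  next
    case True
    then obtain B where B: "A = insert v B" "v \<notin> B"
      by (meson mk_disjoint_insert)
    then have BD: "B \<in> deletion v U"
      using A by (simp add: deletion_def)
    then have cB: "Suc (card B) = i"
      using A B fin by auto
    have "strand_d (W - {v}) (\<lambda>A. - g1 A) B = - f1 B"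
      using g1[OF BD cB] by (simp add: strand_d_def sum_negf)
    then have "koszul_sign v B * strand_d W g A = koszul_sign v B * f A"
      using W A B unfolding g_def by (auto simp: strand_d_glue_insert f1_def)
    then show ?thesis
      by (rule koszul_sign_cancel)
  qed
  then show "\<exists>g. \<forall>A\<in>U. card A = i \<longrightarrow> strand_d W g A = f A"
    by blast
qed

text \<open>Here the faces are joins of a face on \<open>V\<close> with a proper subset of \<open>Q\<close>. The latter form the boundary of a
  simplex, so the join is an iterated suspension, and in the indexing by complements this shifts the degree by
  one. Vertices of \<open>Q\<close> are removed one at a time: deleting a vertex leaves a full simplex on the rest of \<open>Q\<close>,
  which is a cone, and for the last vertex of \<open>Q\<close> the link has no faces at all.\<close>

lemma acyclic_block:
  assumes "finite Q" "Q \<noteq> {}" "finite V" "V \<inter> Q = {}"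
    and up: "\<And>A v. A \<subseteq> V \<Longrightarrow> v \<in> V \<Longrightarrow> P A \<Longrightarrow> P (insert v A)"
    and rest: "i = 0 \<or> acyclic_at T V {A. A \<subseteq> V \<and> P A} (i - 1)"
  shows "acyclic_at T (V \<union> Q) {A. A \<subseteq> V \<union> Q \<and> P (A \<inter> V) \<and> A \<inter> Q \<noteq> {}} i"
  using assms(1,2,4)
proof (induction Q rule: finite_ne_induct)
  case (singleton q)
  let ?U = "{A. A \<subseteq> V \<union> {q} \<and> P (A \<inter> V) \<and> A \<inter> {q} \<noteq> {}}"
  have lnk: "link q ?U = {}"
    by (auto simp: link_def)
  have del: "deletion q ?U = {A. A \<subseteq> V \<and> P A}"
  proof (intro Set.set_eqI)
    fix A
    have "q \<notin> A \<and> insert q A \<subseteq> V \<union> {q} \<longleftrightarrow> A \<subseteq> V"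
      using singleton by blast
    moreover have "insert q A \<inter> V = A" if "A \<subseteq> V"
      using that singleton by blast
    ultimately show "A \<in> deletion q ?U \<longleftrightarrow> A \<in> {A. A \<subseteq> V \<and> P A}"
      unfolding deletion_def mem_Collect_eq by (metis Int_insert_left_if1 insertI1 insert_not_empty)
  qed
  have W: "V \<union> {q} - {q} = V"
    using singleton by auto
  show ?case
  proof (rule acyclic_link_deletion[of _ q])
    show "acyclic_at T (V \<union> {q} - {q}) (link q ?U) i"
      unfolding lnk acyclic_at_def by simp
    show "i = 0 \<or> acyclic_at T (V \<union> {q} - {q}) (deletion q ?U) (i - 1)"
      using rest unfolding del W .
    show "link q ?U \<subseteq> deletion q ?U"
      unfolding lnk by simp
  qed (use \<open>finite V\<close> in auto)
next
  case (insert q Q)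
  let ?U = "{A. A \<subseteq> V \<union> insert q Q \<and> P (A \<inter> V) \<and> A \<inter> insert q Q \<noteq> {}}"
  have W: "V \<union> insert q Q - {q} = V \<union> Q"
    using insert by auto
  have q: "insert q A \<inter> V = A \<inter> V" for A
    using insert by auto
  have lnk: "link q ?U = {A. A \<subseteq> V \<union> Q \<and> P (A \<inter> V) \<and> A \<inter> Q \<noteq> {}}"
    using insert by (auto simp: link_def)
  have del: "deletion q ?U = {A. A \<subseteq> V \<union> Q \<and> P (A \<inter> V)}"
    using insert by (auto simp: deletion_def q)
  obtain r where r: "r \<in> Q"
    using insert by auto
  then have "insert r A \<inter> V = A \<inter> V" for A
    using insert by auto
  then have "acyclic_at T (V \<union> Q) {A. A \<subseteq> V \<union> Q \<and> P (A \<inter> V)} (i - 1)"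
    using insert \<open>finite V\<close> r by (intro acyclic_cone[of _ r]) auto
  then have rest': "acyclic_at T (V \<union> insert q Q - {q}) (deletion q ?U) (i - 1)"
    by (simp only: W del)
  show ?case
  proof (rule acyclic_link_deletion[of _ q])
    show "acyclic_at T (V \<union> insert q Q - {q}) (link q ?U) i"
      unfolding W lnk using insert by simp
    show "link q ?U \<subseteq> deletion q ?U"
      unfolding lnk del by blast
  qed (use rest' insert \<open>finite V\<close> in auto)
qed

section \<open>Subsets of a line without long paths\<close>

text \<open>The complements in \<open>\<phi> ` X\<close> of the sets that contain no path. The vertices of the line are numbered by \<open>X\<close> and
  carry the labels \<open>\<phi>\<close>; keeping the labels makes the result applicable to a cycle cut open at any vertex.\<close>

definition path_complex :: "(nat \<Rightarrow> nat) \<Rightarrow> nat \<Rightarrow> nat set \<Rightarrow> nat set set" where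
  "path_complex \<phi> t X = {A. A \<subseteq> \<phi> ` X \<and> (\<forall>s. {s..<s + t} \<subseteq> X \<longrightarrow> A \<inter> \<phi> ` {s..<s + t} \<noteq> {})}"

text \<open>No path inside \<open>X\<close> passes through the last vertex, so the complex is a cone over it.\<close>

lemma line_end_short:
  assumes inj: "inj_on \<phi> X" and X: "finite X" "m \<in> X" "\<And>x. x \<in> X \<Longrightarrow> x \<le> m"
    and short: "\<not> {m - (t - 1)..m} \<subseteq> X" and "t \<ge> 1"
  shows "acyclic_at T (\<phi> ` X) (path_complex \<phi> t X) i"
proof (rule acyclic_cone[of _ "\<phi> m"])
  fix A
  have "\<phi> m \<notin> \<phi> ` {s..<s + t}" if "{s..<s + t} \<subseteq> X" for s
  proof
    assume "\<phi> m \<in> \<phi> ` {s..<s + t}"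
    then have m: "m \<in> {s..<s + t}"
      using inj_on_image_mem_iff[OF inj \<open>m \<in> X\<close> that] by simp
    moreover have "s + t - 1 \<le> m"
      using that X(3) \<open>t \<ge> 1\<close> by (auto simp: subset_iff)
    ultimately have "{m - (t - 1)..m} \<subseteq> {s..<s + t}"
      by auto
    then show False
      using short that by auto
  qed
  then show "insert (\<phi> m) A \<in> path_complex \<phi> t X \<longleftrightarrow> A \<in> path_complex \<phi> t X"
    using X unfolding path_complex_def by auto
qed (use X in \<open>auto simp: path_complex_def\<close>)

text \<open>Once \<open>m - t\<close> is in a face, the path starting at \<open>m - t\<close> forbids all of \<open>m - t + 1, \<dots>, m - 1\<close> together. This already
  excludes the path ending at \<open>m\<close>, which is the only one through \<open>m\<close>; so the link of \<open>m - t\<close> is a cone over \<open>m\<close>.\<close>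

lemma line_end_long:
  assumes inj: "inj_on \<phi> X" and X: "finite X" "\<And>x. x \<in> X \<Longrightarrow> x \<le> m"
    and long: "{m - t..m} \<subseteq> X" and "t \<ge> 1" "t < m"
    and rest: "i = 0 \<or> acyclic_at T (\<phi> ` (X - {m - t})) (path_complex \<phi> t (X - {m - t})) (i - 1)"
  shows "acyclic_at T (\<phi> ` X) (path_complex \<phi> t X) i"
proof -
  define v where "v = m - t"
  have v: "v \<in> X" "m \<in> X" "v \<noteq> m" "\<phi> v \<noteq> \<phi> m"
    using long \<open>t \<ge> 1\<close> \<open>t < m\<close> inj by (auto simp: v_def subset_iff dest: inj_onD)
  have W: "\<phi> ` X - {\<phi> v} = \<phi> ` (X - {v})"
    using inj v by (auto simp: inj_on_image_set_diff[of \<phi> X])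
  have mem: "\<phi> x \<in> \<phi> ` Y \<longleftrightarrow> x \<in> Y" if "x \<in> X" "Y \<subseteq> X" for x Y
    using inj_on_image_mem_iff[OF inj] that by blast
  have del: "deletion (\<phi> v) (path_complex \<phi> t X) = path_complex \<phi> t (X - {v})"
  proof (intro Set.set_eqI)
    fix A
    have "\<phi> v \<notin> A \<and> insert (\<phi> v) A \<subseteq> \<phi> ` X \<longleftrightarrow> A \<subseteq> \<phi> ` (X - {v})"
      using v by (auto simp flip: W)
    moreover have "(\<forall>s. {s..<s + t} \<subseteq> X \<longrightarrow> insert (\<phi> v) A \<inter> \<phi> ` {s..<s + t} \<noteq> {}) \<longleftrightarrow>
      (\<forall>s. {s..<s + t} \<subseteq> X - {v} \<longrightarrow> A \<inter> \<phi> ` {s..<s + t} \<noteq> {})"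
    proof (intro iff_allI)
      fix s
      show "({s..<s + t} \<subseteq> X \<longrightarrow> insert (\<phi> v) A \<inter> \<phi> ` {s..<s + t} \<noteq> {}) \<longleftrightarrow>
        ({s..<s + t} \<subseteq> X - {v} \<longrightarrow> A \<inter> \<phi> ` {s..<s + t} \<noteq> {})"
        using mem[OF v(1), of "{s..<s + t}"] by blast
    qed
    ultimately show "A \<in> deletion (\<phi> v) (path_complex \<phi> t X) \<longleftrightarrow> A \<in> path_complex \<phi> t (X - {v})"
      unfolding deletion_def path_complex_def by blast
  qed
  show ?thesis
  proof (rule acyclic_link_deletion[of _ "\<phi> v"])
    show "i = 0 \<or> acyclic_at T (\<phi> ` X - {\<phi> v})
        (deletion (\<phi> v) (path_complex \<phi> t X)) (i - 1)"
      using rest unfolding W del unfolding v_def .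
    show "acyclic_at T (\<phi> ` X - {\<phi> v}) (link (\<phi> v) (path_complex \<phi> t X)) i"
    proof (rule acyclic_cone[of _ "\<phi> m"])
      fix A
      assume "\<phi> m \<notin> A"
      have "A \<inter> \<phi> ` {s..<s + t} \<noteq> {}"
        if A: "insert (\<phi> m) A \<in> path_complex \<phi> t X" "\<phi> v \<notin> A" and s: "{s..<s + t} \<subseteq> X" for s
      proof (cases "m \<in> {s..<s + t}")
        case False
        then have "\<phi> m \<notin> \<phi> ` {s..<s + t}"
          using mem v s by blast
        then show ?thesis
          using A s unfolding path_complex_def by blast
      next
        case True
        have "s + t - 1 \<le> m"
          using s X \<open>t \<ge> 1\<close> by (auto simp: subset_iff)
        then have sv: "s = Suc v"
          using True \<open>t < m\<close> by (auto simp: v_def)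
        \<comment> \<open>The path ending at \<open>m\<close> is met by \<open>A\<close> because the path one step to the left is.\<close>
        have sub: "{v..<v + t} \<subseteq> X"
          using long \<open>t < m\<close> by (auto simp: v_def subset_iff)
        moreover have "m \<notin> {v..<v + t}"
          using \<open>t < m\<close> by (auto simp: v_def)
        ultimately have "\<phi> m \<notin> \<phi> ` {v..<v + t}"
          using mem v by blast
        moreover have "insert (\<phi> m) A \<inter> \<phi> ` {v..<v + t} \<noteq> {}"
          using A sub unfolding path_complex_def by blast
        ultimately have "A \<inter> \<phi> ` {v..<v + t} \<noteq> {}"
          by simp
        then obtain x where x: "x \<in> {v..<v + t}" "\<phi> x \<in> A"
          by blast
        then have "x \<noteq> v"
          using A by auto
        then have "x \<in> {s..<s + t}"
          using x sv by auto
        then show ?thesis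
          using x by blast
      qed
      moreover have "insert (\<phi> m) A \<in> path_complex \<phi> t X" if "A \<in> path_complex \<phi> t X"
        using that v unfolding path_complex_def by blast
      ultimately show "insert (\<phi> m) A \<in> link (\<phi> v) (path_complex \<phi> t X) \<longleftrightarrow>
          A \<in> link (\<phi> v) (path_complex \<phi> t X)"
        using v unfolding link_def path_complex_def by auto
    qed (use v X in \<open>auto simp: link_def path_complex_def\<close>)
    show "link (\<phi> v) (path_complex \<phi> t X) \<subseteq> deletion (\<phi> v) (path_complex \<phi> t X)"
      using v unfolding link_def deletion_def path_complex_def by blast
  qed (use v X in \<open>auto simp: path_complex_def\<close>)
qed

text \<open>The last \<open>t\<close> vertices form an isolated path, and no other path inside \<open>X\<close> meets it, so the complex is a join
  with the boundary of a simplex.\<close>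

lemma line_end_exact:
  assumes inj: "inj_on \<phi> X" and X: "finite X" "\<And>x. x \<in> X \<Longrightarrow> x \<le> m"
    and block: "{Suc k..m} \<subseteq> X" "m = k + t" "k \<notin> X" and "t \<ge> 1"
    and rest: "i = 0 \<or> acyclic_at T (\<phi> ` (X - {k..m})) (path_complex \<phi> t (X - {k..m})) (i - 1)"
  shows "acyclic_at T (\<phi> ` X) (path_complex \<phi> t X) i"
proof -
  define Q where "Q = {Suc k..m}"
  define V where "V = X - {k..m}"
  have XVQ: "X = V \<union> Q" "V \<inter> Q = {}"
    using block by (auto simp: V_def Q_def not_less_eq_eq le_Suc_eq Suc_le_eq)
  have sub: "V \<subseteq> X" "Q \<subseteq> X"
    using XVQ by auto
  have disj: "\<phi> ` V \<inter> \<phi> ` Q = {}"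
    using XVQ sub inj by (metis image_empty inj_on_image_Int)
  define P where "P = (\<lambda>A. \<forall>s. {s..<s + t} \<subseteq> V \<longrightarrow> A \<inter> \<phi> ` {s..<s + t} \<noteq> {})"
  have paths: "{s..<s + t} \<subseteq> X \<longleftrightarrow> {s..<s + t} \<subseteq> V \<or> s = Suc k" for s
  proof
    assume s: "{s..<s + t} \<subseteq> X"
    show "{s..<s + t} \<subseteq> V \<or> s = Suc k"
    proof (cases "s + t \<le> k")
      case True
      then show ?thesis
        using s by (auto simp: V_def)
    next
      case False
      have "k \<notin> {s..<s + t}"
        using s block by auto
      moreover have "s + t - 1 \<in> {s..<s + t}"
        using \<open>t \<ge> 1\<close> by auto
      then have "s + t - 1 \<le> m"
        using s X by blast
      ultimately show ?thesis
        using False block by auto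
    qed
  next
    have "{Suc k..<Suc k + t} \<subseteq> X"
      using block by auto
    then show "{s..<s + t} \<subseteq> V \<or> s = Suc k \<Longrightarrow> {s..<s + t} \<subseteq> X"
      using sub by auto
  qed
  have Qeq: "Q = {Suc k..<Suc k + t}"
    using block by (auto simp: Q_def)
  have U: "path_complex \<phi> t X =
      {A. A \<subseteq> \<phi> ` V \<union> \<phi> ` Q \<and> P (A \<inter> \<phi> ` V) \<and> A \<inter> \<phi> ` Q \<noteq> {}}"
  proof (intro Set.set_eqI)
    fix A
    have "(A \<inter> \<phi> ` V) \<inter> \<phi> ` {s..<s + t} = A \<inter> \<phi> ` {s..<s + t}" if "{s..<s + t} \<subseteq> V" for s
      using that by blast
    then have "P (A \<inter> \<phi> ` V) \<longleftrightarrow> P A"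
      by (simp add: P_def)
    moreover have "(\<forall>s. {s..<s + t} \<subseteq> X \<longrightarrow> A \<inter> \<phi> ` {s..<s + t} \<noteq> {}) \<longleftrightarrow> P A \<and> A \<inter> \<phi> ` Q \<noteq> {}"
      unfolding P_def Qeq paths by blast
    ultimately show "A \<in> path_complex \<phi> t X \<longleftrightarrow>
        A \<in> {A. A \<subseteq> \<phi> ` V \<union> \<phi> ` Q \<and> P (A \<inter> \<phi> ` V) \<and> A \<inter> \<phi> ` Q \<noteq> {}}"
      unfolding path_complex_def XVQ(1) image_Un by blast
  qed
  have "acyclic_at T (\<phi> ` V \<union> \<phi> ` Q)
      {A. A \<subseteq> \<phi> ` V \<union> \<phi> ` Q \<and> P (A \<inter> \<phi> ` V) \<and> A \<inter> \<phi> ` Q \<noteq> {}} i"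
  proof (rule acyclic_block)
    show "\<phi> ` Q \<noteq> {}"
      using \<open>t \<ge> 1\<close> by (auto simp: Qeq)
    show "i = 0 \<or> acyclic_at T (\<phi> ` V) {A. A \<subseteq> \<phi> ` V \<and> P A} (i - 1)"
      using rest unfolding V_def[symmetric] path_complex_def P_def .
    show "P (insert v A)" if "P A" for A v
      using that unfolding P_def by blast
  qed (use finite_subset[OF sub(1)] finite_subset[OF sub(2)] X disj in auto)
  then show ?thesis
    unfolding U unfolding XVQ(1) image_Un .
qed

text \<open>Each round of the induction removes a block from the end: either \<open>t\<close> vertices at the cost of one homological
  degree, or \<open>t + 1\<close> vertices at the cost of two. In both cases the next block ends at most at \<open>k - t - 1\<close>, where \<open>k\<close>
  was the last vertex; this gap accounts for the summand 1 in the last inequality.\<close>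

lemma line_nonacyclic_bounds:
  assumes "inj_on \<phi> X" "X \<subseteq> {1..m}" "t \<ge> 1" "\<not> acyclic_at T (\<phi> ` X) (path_complex \<phi> t X) i"
  shows "\<exists>b a. a \<le> b \<and> i = b + a \<and> card X = b * t + a \<and> b * (t + 1) \<le> m + 1"
  using assms
proof (induction "card X" arbitrary: X m i rule: less_induct)
  case less
  have fin: "finite X"
    using less.prems finite_subset by blast
  show ?case
  proof (cases "X = {}")
    case True
    then have "i = 0"
      using less.prems(4) by (auto simp: acyclic_at_def path_complex_def)
    then show ?thesis
      using True by (intro exI[of _ 0]) auto
  next
    case False
    define k where "k = Max X"
    have k: "k \<in> X" "\<And>x. x \<in> X \<Longrightarrow> x \<le> k"
      using fin False by (simp_all add: k_def)
    then have km: "k \<le> m" "k \<ge> 1"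
      using less.prems(2) by auto
    have long: "{k - (t - 1)..k} \<subseteq> X"
      using line_end_short[OF less.prems(1) fin k(1,2)] less.prems by fastforce
    have "0 \<notin> X"
      using less.prems by auto
    have tk: "t \<le> k"
    proof (rule ccontr)
      assume "\<not> t \<le> k"
      then have "0 \<in> {k - (t - 1)..k}"
        by simp
      then show False
        using long \<open>0 \<notin> X\<close> by blast
    qed
    then have blk: "{Suc (k - t)..k} \<subseteq> X"
      using long \<open>t \<ge> 1\<close> by (simp add: Suc_diff_le)
    have rec: "\<exists>b a. a \<le> b \<and> i' = Suc b + a \<and> card X' = Suc b * t + a \<and> Suc b * (t + 1) \<le> m + 1"
      if X': "X' \<subseteq> X" "{Suc (k - t)..k} \<subseteq> X'" "k - t \<notin> X'"
        and na: "\<not> acyclic_at T (\<phi> ` X') (path_complex \<phi> t X') i'" for X' i'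
    proof -
      define Y where "Y = X' - {k - t..k}"
      have inj: "inj_on \<phi> X'"
        using less.prems X' inj_on_subset by blast
      have fin': "finite X'"
        using X' fin finite_subset by blast
      have le: "x \<le> k" if "x \<in> X'" for x
        using that k X' by blast
      have "\<not> (i' = 0 \<or> acyclic_at T (\<phi> ` Y) (path_complex \<phi> t Y) (i' - 1))"
        using line_end_exact[OF inj fin' le X'(2) _ X'(3) \<open>t \<ge> 1\<close>, where i = i' and T = T] tk na
        unfolding Y_def by (metis le_add_diff_inverse2)
      then have na': "i' \<noteq> 0" "\<not> acyclic_at T (\<phi> ` Y) (path_complex \<phi> t Y) (i' - 1)"
        by simp_all
      have split: "X' = Y \<union> {Suc (k - t)..k}"
        using X' by (auto simp: Y_def not_less_eq_eq le_Suc_eq Suc_le_eq)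
      moreover have "Y \<inter> {Suc (k - t)..k} = {}"
        by (auto simp: Y_def)
      moreover have "finite Y"
        using fin' by (simp add: Y_def)
      ultimately have card: "card X' = card Y + t"
        using tk by (simp add: card_Un_disjoint)
      then have "card Y < card X"
        using card_mono[OF fin X'(1)] \<open>t \<ge> 1\<close> by linarith
      moreover have "Y \<subseteq> {1..k - t - 1}"
      proof
        fix x
        assume "x \<in> Y"
        then have "x \<le> k" "x \<ge> 1" "x \<notin> {k - t..k}"
          using X' k less.prems(2) by (auto simp: Y_def)
        then show "x \<in> {1..k - t - 1}"
          by auto
      qed
      moreover have "inj_on \<phi> Y"
        using inj by (auto simp: Y_def intro: inj_on_subset)
      ultimately obtain b a where ba: "a \<le> b" "i' - 1 = b + a" "card Y = b * t + a"
          "b * (t + 1) \<le> k - t - 1 + 1"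
        using less.hyps na'(2) \<open>t \<ge> 1\<close> by blast
      \<comment> \<open>For \<open>k = t\<close> the truncated bound \<open>k - t - 1 + 1\<close> is 1 instead of 0, which still forces \<open>b = 0\<close>.\<close>
      have "b * (t + 1) \<le> k - t"
      proof (cases "k = t")
        case True
        then have "b = 0"
          using ba(4) \<open>t \<ge> 1\<close> by (cases b) auto
        then show ?thesis
          by simp
      qed (use ba(4) tk in auto)
      then have "Suc b * (t + 1) \<le> m + 1"
        using km tk by simp
      then show ?thesis
        using ba card na'(1) by (intro exI[of _ b] exI[of _ a]) auto
    qed
    show ?thesis
    proof (cases "k - t \<in> X")
      case False
      then obtain b a where "a \<le> b" "i = Suc b + a" "card X = Suc b * t + a" "Suc b * (t + 1) \<le> m + 1"
        using rec[OF subset_refl blk _ less.prems(4)] by blast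
      then show ?thesis
        by (intro exI[of _ "Suc b"] exI[of _ a]) auto
    next
      case True
      then have "t < k"
        using tk \<open>0 \<notin> X\<close> by (cases "k = t") auto
      moreover have "{k - t..k} \<subseteq> X"
        using True blk by (metis Icc_eq_insert_lb_nat diff_le_self insert_subset)
      ultimately have "\<not> (i = 0 \<or>
          acyclic_at T (\<phi> ` (X - {k - t})) (path_complex \<phi> t (X - {k - t})) (i - 1))"
        using line_end_long[OF less.prems(1) fin k(2), where t = t and i = i and T = T] less.prems(3,4)
        by metis
      then have "i \<noteq> 0"
        and na: "\<not> acyclic_at T (\<phi> ` (X - {k - t})) (path_complex \<phi> t (X - {k - t})) (i - 1)"
        by simp_all
      moreover have "{Suc (k - t)..k} \<subseteq> X - {k - t}"
        using blk by auto
      ultimately obtain b a where "a \<le> b" "i - 1 = Suc b + a" "card (X - {k - t}) = Suc b * t + a"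
          "Suc b * (t + 1) \<le> m + 1"
        using rec[OF Diff_subset _ _ na] by blast
      moreover have "card X = Suc (card (X - {k - t}))"
        using True fin by (metis card_Suc_Diff1)
      ultimately show ?thesis
        using \<open>i \<noteq> 0\<close> by (intro exI[of _ "Suc b"] exI[of _ "Suc a"]) auto
    qed
  qed
qed

section \<open>Homogeneous polynomials\<close>

abbreviation "keys \<equiv> Poly_Mapping.keys"
abbreviation "lookup \<equiv> Poly_Mapping.lookup"

lemma keys_plus_nat: "keys (a + b :: nat \<Rightarrow>\<^sub>0 nat) = keys a \<union> keys b"
  by (auto simp: in_keys_iff lookup_add)

lemma mono_deg_superset:
  "finite V \<Longrightarrow> keys m \<subseteq> V \<Longrightarrow> mono_deg m = (\<Sum>v\<in>V. lookup m v)"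
  unfolding mono_deg_def by (rule sum.mono_neutral_left) (auto simp: in_keys_iff)

lemma mono_deg_add: "mono_deg (a + b) = mono_deg a + mono_deg b"
proof -
  have "mono_deg c = (\<Sum>v\<in>keys a \<union> keys b. lookup c v)" if "c \<in> {a, b, a + b}" for c
    using that by (intro mono_deg_superset) (auto simp: keys_plus_nat)
  then show ?thesis
    by (simp add: lookup_add sum.distrib)
qed

lemma keys_mult_cases:
  assumes "m \<in> keys (f * g)"
  obtains a b where "m = a + b" "a \<in> keys f" "b \<in> keys g"
  using assms keys_mult[of f g] by blast

lemma poly_ring_zero: "0 \<in> poly_ring n"
  by (simp add: poly_ring_def)

lemma poly_ring_add: "f \<in> poly_ring n \<Longrightarrow> g \<in> poly_ring n \<Longrightarrow> f + g \<in> poly_ring n"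
  using keys_add[of f g] unfolding poly_ring_def by blast

lemma poly_ring_mult:
  assumes "f \<in> poly_ring n" "g \<in> poly_ring n"
  shows "f * g \<in> poly_ring n"
  using assms unfolding poly_ring_def
  by (fastforce elim!: keys_mult_cases simp: keys_plus_nat)

definition forms :: "nat \<Rightarrow> int \<Rightarrow> 'k::field mpoly set" where
  "forms n d = {f \<in> poly_ring n. \<forall>m\<in>keys f. int (mono_deg m) = d}"

lemma forms_poly_ring: "f \<in> forms n d \<Longrightarrow> f \<in> poly_ring n"
  by (simp add: forms_def)

lemma forms_zero: "0 \<in> forms n d"
  by (simp add: forms_def poly_ring_zero)

lemma forms_add: "f \<in> forms n d \<Longrightarrow> g \<in> forms n d \<Longrightarrow> f + g \<in> forms n d"
  using keys_add[of f g] unfolding forms_def by (blast intro: poly_ring_add)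

lemma forms_uminus: "f \<in> forms n d \<Longrightarrow> - f \<in> forms n d"
  unfolding forms_def poly_ring_def by (auto simp: in_keys_iff)

lemma forms_diff: "f \<in> forms n d \<Longrightarrow> g \<in> forms n d \<Longrightarrow> f - g \<in> forms n d"
  using forms_add[OF _ forms_uminus] by fastforce

lemma forms_sum: "(\<And>x. x \<in> X \<Longrightarrow> f x \<in> forms n d) \<Longrightarrow> sum f X \<in> forms n d"
  by (induction X rule: infinite_finite_induct) (auto intro: forms_zero forms_add)

lemma forms_mult:
  assumes "f \<in> forms n c" "g \<in> forms n d"
  shows "f * g \<in> forms n (c + d)"
  using assms poly_ring_mult[of f n g] unfolding forms_def
  by (auto elim!: keys_mult_cases simp: mono_deg_add)

lemma forms_Var: "v \<in> {1..n} \<Longrightarrow> Var v \<in> forms n 1"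
  unfolding forms_def poly_ring_def Var_def by (auto simp: mono_deg_def)

lemma koszul_sign_cases: "koszul_sign v A = (1 :: 'a::comm_ring_1) \<and> koszul_sign v A = (1 :: 'b::comm_ring_1)
    \<or> koszul_sign v A = (- 1 :: 'a) \<and> koszul_sign v A = (- 1 :: 'b)"
  unfolding koszul_sign_def by (cases "even (card {a \<in> A. a < v})") simp_all

lemma forms_koszul_sign: "f \<in> forms n d \<Longrightarrow> koszul_sign v A * f \<in> forms n d"
  using koszul_sign_cases[of v A, where 'a = "'a mpoly"] forms_uminus by auto

lemma lookup_koszul_sign:
  "lookup (koszul_sign v A * f :: 'k::field mpoly) m = koszul_sign v A * lookup f m"
  using koszul_sign_cases[of v A, where 'a = "'k mpoly" and 'b = 'k] by auto

lemma lookup_Var_mult: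
  "lookup (Var v * f :: 'k::field mpoly) m =
    (if v \<in> keys m then lookup f (m - Poly_Mapping.single v 1) else 0)"
proof -
  let ?s = "Poly_Mapping.single v 1 :: nat \<Rightarrow>\<^sub>0 nat"
  have "lookup (Var v * f) m = Sum_any (\<lambda>q. lookup f q when m = ?s + q)"
    by (simp add: Var_def lookup_mult lookup_single when_mult)
  also have "\<dots> = (if v \<in> keys m then lookup f (m - ?s) else 0)"
  proof (cases "v \<in> keys m")
    case True
    have "m = ?s + q \<longleftrightarrow> q = m - ?s" for q
    proof
      assume "q = m - ?s"
      then show "m = ?s + q"
        using True by (auto simp: poly_mapping_eq_iff lookup_add lookup_minus lookup_single in_keys_iff fun_eq_iff when_def)
    qed auto
    then show ?thesis
      using True by simp
  next
    case False
    then have "m \<noteq> ?s + q" for q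
      by (auto simp: keys_plus_nat)
    then show ?thesis
      using False by simp
  qed
  finally show ?thesis .
qed

section \<open>The Koszul complex modulo a set of monomials\<close>

definition sqfree :: "nat set \<Rightarrow> nat \<Rightarrow>\<^sub>0 nat" where
  "sqfree A = (\<Sum>v\<in>A. Poly_Mapping.single v 1)"

lemma lookup_sqfree: "finite A \<Longrightarrow> lookup (sqfree A) v = (if v \<in> A then 1 else 0)"
  by (simp add: sqfree_def lookup_sum lookup_single when_def)

lemma keys_sqfree: "finite A \<Longrightarrow> keys (sqfree A) = A"
  by (auto simp: in_keys_iff lookup_sqfree split: if_splits)

lemma mono_deg_sqfree: "finite A \<Longrightarrow> mono_deg (sqfree A) = card A"
  by (simp add: mono_deg_def keys_sqfree lookup_sqfree)

lemma sqfree_diff_add: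
  assumes "A \<subseteq> keys e"
  shows "e - sqfree A + sqfree A = e"
  using assms finite_subset[OF assms] 
  by (auto simp: poly_mapping_eq_iff lookup_add lookup_minus lookup_sqfree in_keys_iff fun_eq_iff subset_iff)

text \<open>Chains of the Koszul complex are functions on index sets, the value at \<open>A\<close> being the coefficient of the
  exterior monomial \<open>e\<^sub>A\<close>.\<close>

definition koszul_d :: "nat \<Rightarrow> (nat set \<Rightarrow> 'k::field mpoly) \<Rightarrow> nat set \<Rightarrow> 'k mpoly" where
  "koszul_d n z A = (\<Sum>v\<in>{1..n} - A. koszul_sign v A * (Var v * z (insert v A)))"

text \<open>The part of the Koszul complex in multidegree \<open>e\<close> sits in the coefficients of \<open>e\<^sub>A\<close> at \<open>x\<^bsup>e - A\<^esup>\<close>.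
  For an index \<open>v\<close> outside \<open>A\<close>, the monomial \<open>x\<^bsup>e - A\<^esup>\<close> is divisible by \<open>x\<^sub>v\<close> exactly if \<open>v\<close> is in the support of \<open>e\<close>,
  so on this part the Koszul differential is \<open>strand_d\<close> even if \<open>e\<close> is not squarefree.\<close>

lemma lookup_koszul_d:
  fixes z :: "nat set \<Rightarrow> 'k::field mpoly"
  assumes "keys e \<subseteq> {1..n}" "A \<subseteq> keys e"
  shows "lookup (koszul_d n z A) (e - sqfree A) = strand_d (keys e) (\<lambda>B. lookup (z B) (e - sqfree B)) A"
proof -
  have fin: "finite A"
    using assms finite_subset finite_keys by blast
  have "lookup (Var v * z (insert v A)) (e - sqfree A) =
      (if v \<in> keys e then lookup (z (insert v A)) (e - sqfree (insert v A)) else 0)" if "v \<notin> A" for v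
  proof -
    have "v \<in> keys (e - sqfree A) \<longleftrightarrow> v \<in> keys e"
      using that fin by (simp add: in_keys_iff lookup_minus lookup_sqfree)
    moreover have "e - sqfree A - Poly_Mapping.single v 1 = e - sqfree (insert v A)"
      using that fin by (simp add: sqfree_def add.commute diff_diff_add)
    ultimately show ?thesis
      by (simp add: lookup_Var_mult)
  qed
  then have "lookup (koszul_d n z A) (e - sqfree A) = (\<Sum>v\<in>{1..n} - A.
      if v \<in> keys e then koszul_sign v A * lookup (z (insert v A)) (e - sqfree (insert v A)) else 0)"
    unfolding koszul_d_def lookup_sum by (intro sum.cong) (auto simp: lookup_koszul_sign)
  also have "\<dots> = strand_d (keys e) (\<lambda>B. lookup (z B) (e - sqfree B)) A"
  proof -
    have "keys e - A = ({1..n} - A) \<inter> {v. v \<in> keys e}"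
      using assms by auto
    then show ?thesis
      unfolding strand_d_def by (simp only: sum.inter_restrict finite_Diff finite_atLeastAtMost mem_Collect_eq)
  qed
  finally show ?thesis .
qed

lemma koszul_d_forms:
  assumes "\<And>v. v \<in> {1..n} - A \<Longrightarrow> z (insert v A) \<in> forms n d"
  shows "koszul_d n z A \<in> forms n (d + 1)"
proof -
  have "koszul_sign v A * (Var v * z (insert v A)) \<in> forms n (d + 1)" if "v \<in> {1..n} - A" for v
    using forms_koszul_sign[OF forms_mult[OF forms_Var assms[OF that]], of v v A] that
    by (simp add: add.commute)
  then show ?thesis
    unfolding koszul_d_def by (rule forms_sum)
qed

lemma sum_antisymmetric:
  fixes g :: "'b \<Rightarrow> 'b \<Rightarrow> 'a::ab_group_add"
  assumes "finite X" "\<And>v w. v \<in> X \<Longrightarrow> w \<in> X \<Longrightarrow> v \<noteq> w \<Longrightarrow> g v w = - g w v"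
  shows "(\<Sum>v\<in>X. \<Sum>w\<in>X - {v}. g v w) = 0"
  using assms
proof (induction X rule: finite_induct)
  case (insert x X)
  have "(\<Sum>w\<in>insert x X - {v}. g v w) = g v x + (\<Sum>w\<in>X - {v}. g v w)" if "v \<in> X" for v
  proof -
    have "insert x X - {v} = insert x (X - {v})"
      using insert.hyps that by auto
    then show ?thesis
      using insert.hyps by simp
  qed
  moreover have "insert x X - {x} = X"
    using insert.hyps by auto
  moreover have "(\<Sum>v\<in>X. g v x) = - (\<Sum>w\<in>X. g x w)"
    unfolding sum_negf[symmetric]
  proof (intro sum.cong refl)
    show "g v x = - g x v" if "v \<in> X" for v
      using insert.prems[of v x] insert.hyps that by blast
  qed
  moreover have "(\<Sum>v\<in>X. \<Sum>w\<in>X - {v}. g v w) = 0"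
    using insert.prems by (intro insert.IH) blast
  ultimately show ?case
    using insert.hyps by (simp add: sum.distrib)
qed simp

lemma koszul_d_koszul_d:
  assumes "finite A"
  shows "koszul_d n (koszul_d n z) A = 0"
proof -
  let ?g = "\<lambda>v w. koszul_sign v A * koszul_sign w (insert v A) * (Var v * (Var w * z (insert w (insert v A))))"
  have "koszul_sign v A * (Var v * koszul_d n z (insert v A)) = (\<Sum>w\<in>{1..n} - A - {v}. ?g v w)" for v
  proof -
    have "{1..n} - insert v A = {1..n} - A - {v}"
      by auto
    then show ?thesis
      unfolding koszul_d_def sum_distrib_left by (simp only: mult.assoc mult.left_commute)
  qed
  then have "koszul_d n (koszul_d n z) A = (\<Sum>v\<in>{1..n} - A. \<Sum>w\<in>{1..n} - A - {v}. ?g v w)"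
    unfolding koszul_d_def[of n "koszul_d n z"] by simp
  also have "\<dots> = 0"
  proof (rule sum_antisymmetric)
    fix v w
    assume "v \<in> {1..n} - A" "w \<in> {1..n} - A" "v \<noteq> w"
    then have "koszul_sign v A * koszul_sign w (insert v A) =
        - (koszul_sign w A * koszul_sign v (insert w A) :: 'a mpoly)"
      using assms by (intro koszul_sign_swap) auto
    then show "?g v w = - ?g w v"
      by (simp only: insert_commute[of v w] mult.left_commute[of "Var v" "Var w"] minus_mult_left)
  qed simp
  finally show ?thesis .
qed

text \<open>A cycle modulo the monomials in \<open>M\<close> is a boundary modulo \<open>M\<close> as soon as each strand that it meets is acyclic:
  only finitely many multidegrees occur in it, and the preimages found in these strands add up to a polynomial
  preimage. It is homogeneous because the multidegrees are those of the cycle.\<close>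

lemma koszul_exact_mod_monomials:
  fixes z :: "nat set \<Rightarrow> 'k::field mpoly"
  assumes z: "\<And>A. A \<subseteq> {1..n} \<Longrightarrow> card A = q \<Longrightarrow> z A \<in> forms n (d - int q)"
    and cycle: "\<And>A m. A \<subseteq> {1..n} \<Longrightarrow> Suc (card A) = q \<Longrightarrow> m \<notin> M \<Longrightarrow> lookup (koszul_d n z A) m = 0"
    and acyclic: "\<And>A m. A \<subseteq> {1..n} \<Longrightarrow> card A = q \<Longrightarrow> m \<in> keys (z A) \<Longrightarrow>
      acyclic_at TYPE('k) (keys (m + sqfree A)) {B. B \<subseteq> keys (m + sqfree A) \<and> m + sqfree A - sqfree B \<notin> M} q"
  shows "\<exists>w. (\<forall>A. A \<subseteq> {1..n} \<longrightarrow> card A = Suc q \<longrightarrow> w A \<in> forms n (d - int (Suc q))) \<and>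
    (\<forall>A m. A \<subseteq> {1..n} \<longrightarrow> card A = q \<longrightarrow> m \<notin> M \<longrightarrow> lookup (koszul_d n w A) m = lookup (z A) m)"
proof -
  \<comment> \<open>The multidegrees in which \<open>z\<close> has a nonzero component.\<close>
  define E where "E = (\<Union>A\<in>{A. A \<subseteq> {1..n} \<and> card A = q}. (\<lambda>m. m + sqfree A) ` keys (z A))"
  have finE: "finite E"
    unfolding E_def by (intro finite_UN_I finite_imageI finite_keys) simp
  have fin: "finite A" if "A \<subseteq> {1..n}" for A :: "nat set"
    using that finite_subset by blast
  have E_deg: "keys e \<subseteq> {1..n}" "int (mono_deg e) = d" if "e \<in> E" for e
  proof -
    from that obtain A m where A: "A \<subseteq> {1..n}" "card A = q" "m \<in> keys (z A)" "e = m + sqfree A"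
      unfolding E_def by blast
    then show "keys e \<subseteq> {1..n}" "int (mono_deg e) = d"
      using z[OF A(1,2)] fin[OF A(1)]
      by (auto simp: forms_def poly_ring_def keys_plus_nat keys_sqfree mono_deg_add mono_deg_sqfree)
  qed
  have "\<exists>g. \<forall>A. A \<subseteq> keys e \<and> e - sqfree A \<notin> M \<and> card A = q \<longrightarrow>
      strand_d (keys e) g A = lookup (z A) (e - sqfree A)" if e: "e \<in> E" for e
  proof -
    let ?U = "{B. B \<subseteq> keys e \<and> e - sqfree B \<notin> M}"
    from e obtain A m where "A \<subseteq> {1..n}" "card A = q" "m \<in> keys (z A)" "e = m + sqfree A"
      unfolding E_def by blast
    then have "acyclic_at TYPE('k) (keys e) ?U q"
      using acyclic by blast
    moreover have "\<forall>A\<in>?U. Suc (card A) = q \<longrightarrow> strand_d (keys e) (\<lambda>A. lookup (z A) (e - sqfree A)) A = 0"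
    proof (intro ballI impI)
      fix A
      assume A: "A \<in> ?U" "Suc (card A) = q"
      then have "lookup (koszul_d n z A) (e - sqfree A) = 0"
        using E_deg[OF e] by (intro cycle) auto
      then show "strand_d (keys e) (\<lambda>A. lookup (z A) (e - sqfree A)) A = 0"
        using lookup_koszul_d[of e n A z] A E_deg[OF e] by simp
    qed
    ultimately have "\<exists>g. \<forall>A\<in>?U. card A = q \<longrightarrow> strand_d (keys e) g A = lookup (z A) (e - sqfree A)"
      unfolding acyclic_at_def by blast
    then show ?thesis
      by blast
  qed
  then obtain g where g: "strand_d (keys e) (g e) A = lookup (z A) (e - sqfree A)"
    if "e \<in> E" "A \<subseteq> keys e" "e - sqfree A \<notin> M" "card A = q" for e A
    by metis
  define w where "w = (\<lambda>A. \<Sum>e\<in>{e\<in>E. A \<subseteq> keys e}. Poly_Mapping.single (e - sqfree A) (g e A))"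
  have lookup_w: "lookup (w A) (e - sqfree A) = (if e \<in> E then g e A else 0)" if A: "A \<subseteq> keys e" for e A
  proof -
    have "e' - sqfree A = e - sqfree A \<longleftrightarrow> e' = e" if "A \<subseteq> keys e'" for e'
      using that A sqfree_diff_add by metis
    then have "lookup (w A) (e - sqfree A) = (\<Sum>e'\<in>{e'\<in>E. A \<subseteq> keys e'}. if e' = e then g e A else 0)"
      unfolding w_def lookup_sum by (intro sum.cong) (auto simp: lookup_single when_def)
    then show ?thesis
      using finE A by (simp add: sum.delta)
  qed
  have w_forms: "w A \<in> forms n (d - int (Suc q))" if A: "A \<subseteq> {1..n}" "card A = Suc q" for A
  proof -
    have "Poly_Mapping.single (e - sqfree A) (g e A) \<in> forms n (d - int (Suc q))"
      if "e \<in> E" "A \<subseteq> keys e" for e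
    proof -
      have "keys (e - sqfree A) \<subseteq> keys e"
        by (auto simp: in_keys_iff lookup_minus)
      moreover have "mono_deg (e - sqfree A) + card A = mono_deg e"
        using sqfree_diff_add[OF that(2)] mono_deg_add[of "e - sqfree A" "sqfree A"] fin[OF A(1)]
        by (simp add: mono_deg_sqfree)
      ultimately show ?thesis
        using E_deg[OF that(1)] A by (auto simp: forms_def poly_ring_def)
    qed
    then show ?thesis
      unfolding w_def by (intro forms_sum) auto
  qed
  have "lookup (koszul_d n w A) m = lookup (z A) m"
    if A: "A \<subseteq> {1..n}" "card A = q" and m: "m \<notin> M" for A m
  proof -
    define e where "e = m + sqfree A"
    have sub: "A \<subseteq> keys e" and me: "m = e - sqfree A"
      using fin[OF A(1)] by (auto simp: e_def keys_plus_nat keys_sqfree)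
    show ?thesis
    proof (cases "keys e \<subseteq> {1..n}")
      case True
      have eq: "lookup (koszul_d n w A) m = strand_d (keys e) (\<lambda>B. lookup (w B) (e - sqfree B)) A"
        using lookup_koszul_d[OF True sub] me by simp
      show ?thesis
      proof (cases "e \<in> E")
        case True
        have "strand_d (keys e) (\<lambda>B. lookup (w B) (e - sqfree B)) A = strand_d (keys e) (g e) A"
          by (rule strand_d_cong) (use True sub in \<open>auto simp: lookup_w\<close>)
        then show ?thesis
          using eq g[OF True sub] A m me by simp
      next
        case False
        have "strand_d (keys e) (\<lambda>B. lookup (w B) (e - sqfree B)) A = strand_d (keys e) (\<lambda>B. 0) A"
          by (rule strand_d_cong) (use False sub in \<open>auto simp: lookup_w\<close>)
        moreover have "m \<notin> keys (z A)"
          using False A unfolding E_def e_def by blast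
        ultimately show ?thesis
          using eq by (simp add: strand_d_def in_keys_iff)
      qed
    next
      case False
      have "w (insert v A) \<in> forms n (d - int (Suc q))" if "v \<in> {1..n} - A" for v
        using that A fin[OF A(1)] by (intro w_forms) auto
      then have "koszul_d n w A \<in> poly_ring n" "z A \<in> poly_ring n"
        using z[OF A] koszul_d_forms[of n A w "d - int (Suc q)"] by (auto dest: forms_poly_ring)
      moreover have "\<not> keys m \<subseteq> {1..n}"
        using False A fin[OF A(1)] by (auto simp: e_def keys_plus_nat keys_sqfree)
      ultimately have "m \<notin> keys (koszul_d n w A)" "m \<notin> keys (z A)"
        unfolding poly_ring_def by blast+
      then show ?thesis
        by (simp add: in_keys_iff)
    qed
  qed
  then show ?thesis
    using w_forms by blast
qed

lemma keys_empty_iff: "keys f = {} \<longleftrightarrow> f = 0"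
  by (auto simp: poly_mapping_eq_iff in_keys_iff fun_eq_iff)

lemma lookup_mult_zero:
  assumes "lookup f 0 = 0"
  shows "lookup (f * g :: 'k::field mpoly) 0 = 0"
proof (rule ccontr)
  assume "lookup (f * g) 0 \<noteq> 0"
  then obtain a b where ab: "0 = a + b" "a \<in> keys f"
    by (metis in_keys_iff keys_mult_cases)
  then have "keys a = {}"
    by (metis Un_empty keys_plus_nat keys_zero)
  then have "a = 0"
    by (metis keys_empty_iff)
  then show False
    using ab assms by (simp add: in_keys_iff)
qed

lemma lookup_koszul_d_zero: "lookup (koszul_d n z A :: 'k::field mpoly) 0 = 0"
  unfolding koszul_d_def lookup_sum by (intro sum.neutral) (simp add: lookup_koszul_sign lookup_Var_mult)

text \<open>Without an ideal the strand is the full cube, a cone over any variable; only degree \<open>0\<close> of the empty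
  strand survives, and it carries the residue field.\<close>

lemma acyclic_full_cube:
  assumes "W \<noteq> {} \<or> q > 0" "finite W"
  shows "acyclic_at T W (Pow W) q"
proof (cases "W = {}")
  case True
  then show ?thesis
    using assms by (simp add: acyclic_at_def)
next
  case False
  then obtain v where "v \<in> W"
    by blast
  then show ?thesis
    using assms by (intro acyclic_cone[of _ v]) auto
qed

lemma koszul_exact:
  fixes z :: "nat set \<Rightarrow> 'k::field mpoly"
  assumes z: "\<And>A. A \<subseteq> {1..n} \<Longrightarrow> card A = q \<Longrightarrow> z A \<in> forms n (d - int q)"
    and cycle: "\<And>A. A \<subseteq> {1..n} \<Longrightarrow> Suc (card A) = q \<Longrightarrow> koszul_d n z A = 0"
    and q0: "q = 0 \<Longrightarrow> lookup (z {}) 0 = 0"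
  shows "\<exists>w. (\<forall>A. A \<subseteq> {1..n} \<longrightarrow> card A = Suc q \<longrightarrow> w A \<in> forms n (d - int (Suc q))) \<and>
    (\<forall>A. A \<subseteq> {1..n} \<longrightarrow> card A = q \<longrightarrow> koszul_d n w A = z A)"
proof -
  have "acyclic_at TYPE('k) (keys (m + sqfree A))
      {B. B \<subseteq> keys (m + sqfree A) \<and> m + sqfree A - sqfree B \<notin> {}} q"
    if A: "A \<subseteq> {1..n}" "card A = q" "m \<in> keys (z A)" for A m
  proof -
    have fin: "finite A"
      using A finite_subset by blast
    have "keys (m + sqfree A) \<noteq> {} \<or> q > 0"
    proof (rule ccontr)
      assume neg: "\<not> (keys (m + sqfree A) \<noteq> {} \<or> q > 0)"
      then have "A = {}"
        using A fin by simp
      moreover have "m = 0"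
        using neg by (simp add: keys_plus_nat)
      ultimately show False
        using neg q0 A by (simp add: in_keys_iff)
    qed
    then show ?thesis
      using acyclic_full_cube[of "keys (m + sqfree A)" q] by (simp add: Pow_def)
  qed
  note acyclic = this
  have "lookup (koszul_d n z A) m = 0" if "A \<subseteq> {1..n}" "Suc (card A) = q" "m \<notin> {}" for A m
    using cycle that by simp
  with z have "\<exists>w. (\<forall>A. A \<subseteq> {1..n} \<longrightarrow> card A = Suc q \<longrightarrow> w A \<in> forms n (d - int (Suc q))) \<and>
      (\<forall>A m. A \<subseteq> {1..n} \<longrightarrow> card A = q \<longrightarrow> m \<notin> {} \<longrightarrow> lookup (koszul_d n w A) m = lookup (z A) m)"
    using acyclic by (rule koszul_exact_mod_monomials)
  then show ?thesis
    by (auto intro!: poly_mapping_eqI)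
qed

lemma homogeneous_part:
  fixes f :: "'k::field mpoly"
  assumes "f \<in> poly_ring n"
  obtains g where "g \<in> forms n c" "\<And>m. m \<in> keys (f - g) \<Longrightarrow> int (mono_deg m) \<noteq> c"
proof -
  define K where "K = {m \<in> keys f. int (mono_deg m) = c}"
  define g where "g = (\<Sum>m\<in>K. Poly_Mapping.single m (lookup f m))"
  have "finite K"
    by (simp add: K_def)
  then have "lookup g m = (if m \<in> K then lookup f m else 0)" for m
    by (simp add: g_def lookup_sum lookup_single when_def)
  then have "int (mono_deg m) \<noteq> c" if "m \<in> keys (f - g)" for m
    using that by (auto simp: in_keys_iff lookup_minus K_def split: if_splits)
  moreover have "g \<in> forms n c"
    unfolding g_def by (rule forms_sum) (use assms in \<open>auto simp: forms_def poly_ring_def K_def\<close>)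
  ultimately show ?thesis
    using that by blast
qed

section \<open>From minimal resolutions to Koszul homology\<close>

locale minimal_resolution =
  fixes n :: nat and I :: "'k::field mpoly set" and S :: "nat \<Rightarrow> int list"
    and D :: "nat \<Rightarrow> 'k mpoly mat"
  assumes res: "minimal_graded_free_resolution n I S D"
begin

abbreviation rank :: "nat \<Rightarrow> nat" where
  "rank i \<equiv> length (S i)"

text \<open>Elements of the free modules are given by their coefficient functions, of which only the values below the
  rank matter; this avoids vectors when forming the double complex.\<close>

definition res_d :: "nat \<Rightarrow> (nat \<Rightarrow> 'k mpoly) \<Rightarrow> nat \<Rightarrow> 'k mpoly" where
  "res_d i y r = (\<Sum>k<rank (Suc i). D i $$ (r, k) * y k)"

lemma S_0: "S 0 = [0]"
  using res by (simp add: minimal_graded_free_resolution_def)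

lemma D_carrier: "D i \<in> carrier_mat (rank i) (rank (Suc i))"
  using res by (simp add: minimal_graded_free_resolution_def graded_map_def)

lemma entry_forms:
  "r < rank i \<Longrightarrow> k < rank (Suc i) \<Longrightarrow> D i $$ (r, k) \<in> forms n (S (Suc i) ! k - S i ! r)"
  using res by (simp add: minimal_graded_free_resolution_def graded_map_def forms_def)

lemma entry_minimal: "r < rank i \<Longrightarrow> k < rank (Suc i) \<Longrightarrow> lookup (D i $$ (r, k)) 0 = 0"
  using res D_carrier[of i] by (simp add: minimal_graded_free_resolution_def minimal_map_def)

lemma exact: "map_kernel n (D i) = map_image n (D (Suc i))"
  using res by (simp add: minimal_graded_free_resolution_def)

lemma image_D_0: "(\<lambda>v. v $ 0) ` map_image n (D 0) = I"
  using res by (simp add: minimal_graded_free_resolution_def)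

lemma mult_vec_index:
  "r < rank i \<Longrightarrow> (D i *\<^sub>v vec (rank (Suc i)) y) $ r = res_d i y r"
  using D_carrier[of i] by (auto simp: res_d_def scalar_prod_def lessThan_atLeast0 intro!: sum.cong)

lemma mult_vec: "D i *\<^sub>v vec (rank (Suc i)) y = vec (rank i) (res_d i y)"
  using D_carrier[of i] mult_vec_index[of _ i y] by (intro eq_vecI) auto

lemma res_d_forms:
  assumes "\<And>k. k < rank (Suc i) \<Longrightarrow> y k \<in> forms n (c - S (Suc i) ! k)" "r < rank i"
  shows "res_d i y r \<in> forms n (c - S i ! r)"
  unfolding res_d_def
proof (rule forms_sum)
  fix k
  assume "k \<in> {..<rank (Suc i)}"
  then show "D i $$ (r, k) * y k \<in> forms n (c - S i ! r)"
    using forms_mult[OF entry_forms assms(1)] assms(2) by fastforce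
qed

lemma res_d_minimal: "r < rank i \<Longrightarrow> lookup (res_d i y r) 0 = 0"
  unfolding res_d_def lookup_sum by (intro sum.neutral) (simp add: lookup_mult_zero entry_minimal)

lemma res_d_cong: "(\<And>k. k < rank (Suc i) \<Longrightarrow> x k = y k) \<Longrightarrow> res_d i x r = res_d i y r"
  by (simp add: res_d_def)

lemma res_d_diff: "res_d i (\<lambda>k. x k - y k) r = res_d i x r - res_d i y r"
  by (simp add: res_d_def right_diff_distrib sum_subtractf)

lemma res_d_koszul_d: "res_d i (\<lambda>k. koszul_d n (\<lambda>B. z B k) A) r = koszul_d n (\<lambda>B. res_d i (z B) r) A"
proof -
  have "res_d i (\<lambda>k. koszul_d n (\<lambda>B. z B k) A) r = (\<Sum>k<rank (Suc i). \<Sum>v\<in>{1..n} - A.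
      koszul_sign v A * (Var v * (D i $$ (r, k) * z (insert v A) k)))"
    by (simp add: res_d_def koszul_d_def sum_distrib_left ac_simps)
  also have "\<dots> = koszul_d n (\<lambda>B. res_d i (z B) r) A"
    by (subst sum.swap) (simp add: res_d_def koszul_d_def sum_distrib_left)
  finally show ?thesis .
qed

lemma res_d_res_d:
  assumes "\<And>k. k < rank (Suc (Suc i)) \<Longrightarrow> y k \<in> poly_ring n" "r < rank i"
  shows "res_d i (res_d (Suc i) y) r = 0"
proof -
  have "vec (rank (Suc (Suc i))) y \<in> free_module n (dim_col (D (Suc i)))"
    using assms D_carrier[of "Suc i"] by (auto simp: free_module_def)
  then have "D (Suc i) *\<^sub>v vec (rank (Suc (Suc i))) y \<in> map_image n (D (Suc i))"
    unfolding map_image_def by blast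
  then have "vec (rank (Suc i)) (res_d (Suc i) y) \<in> mat_kernel (D i)"
    using exact[of i] by (auto simp: mult_vec map_kernel_def)
  then have "vec (rank i) (res_d i (res_d (Suc i) y)) = 0\<^sub>v (rank i)"
    using D_carrier[of i] by (simp add: mat_kernel_def mult_vec)
  then show ?thesis
    using assms(2) by (metis index_vec index_zero_vec(1))
qed

text \<open>If the image of \<open>x\<close> is homogeneous, then the homogeneous part of \<open>x\<close> in the matching degree has the same
  image: the rest of \<open>x\<close> is mapped to polynomials that have no term in this degree.\<close>

lemma res_d_homogeneous:
  assumes x: "\<And>k. k < rank (Suc i) \<Longrightarrow> x k \<in> poly_ring n"
    and y: "\<And>r. r < rank i \<Longrightarrow> res_d i x r \<in> forms n (c - S i ! r)"
  shows "\<exists>x'. (\<forall>k<rank (Suc i). x' k \<in> forms n (c - S (Suc i) ! k)) \<and>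
    (\<forall>r<rank i. res_d i x' r = res_d i x r)"
proof -
  have "\<exists>g. g \<in> forms n (c - S (Suc i) ! k) \<and>
      (\<forall>m\<in>keys (x k - g). int (mono_deg m) \<noteq> c - S (Suc i) ! k)" if "k < rank (Suc i)" for k
    using homogeneous_part[OF x[OF that]] by metis
  then obtain x' where "\<forall>k<rank (Suc i). x' k \<in> forms n (c - S (Suc i) ! k) \<and>
      (\<forall>m\<in>keys (x k - x' k). int (mono_deg m) \<noteq> c - S (Suc i) ! k)"
    by metis
  then have x': "\<And>k. k < rank (Suc i) \<Longrightarrow> x' k \<in> forms n (c - S (Suc i) ! k)"
    "\<And>k m. k < rank (Suc i) \<Longrightarrow> m \<in> keys (x k - x' k) \<Longrightarrow> int (mono_deg m) \<noteq> c - S (Suc i) ! k"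
    by blast+
  have "res_d i x' r = res_d i x r" if r: "r < rank i" for r
  proof -
    let ?h = "res_d i x r - res_d i x' r"
    have "?h \<in> forms n (c - S i ! r)"
      using y[OF r] res_d_forms[OF x'(1) r] by (rule forms_diff)
    moreover have "int (mono_deg m) \<noteq> c - S i ! r" if m: "m \<in> keys ?h" for m
    proof -
      have "?h = (\<Sum>k<rank (Suc i). D i $$ (r, k) * (x k - x' k))"
        by (simp add: res_d_def right_diff_distrib sum_subtractf)
      then have "\<exists>k<rank (Suc i). lookup (D i $$ (r, k) * (x k - x' k)) m \<noteq> 0"
        using m by (auto simp: in_keys_iff lookup_sum dest: sum.not_neutral_contains_not_neutral)
      then obtain k where k: "k < rank (Suc i)" "m \<in> keys (D i $$ (r, k) * (x k - x' k))"
        by (auto simp: in_keys_iff)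
      then obtain a b where "m = a + b" "a \<in> keys (D i $$ (r, k))" "b \<in> keys (x k - x' k)"
        using keys_mult_cases by metis
      then show ?thesis
        using entry_forms[OF r k(1)] x'(2)[OF k(1), of b] by (auto simp: forms_def mono_deg_add)
    qed
    ultimately have "keys ?h = {}"
      by (auto simp: forms_def)
    then show ?thesis
      by (metis eq_iff_diff_eq_0 keys_empty_iff)
  qed
  then show ?thesis
    using x'(1) by blast
qed

lemma free_module_coefficients:
  assumes "v \<in> map_image n (D i)"
  obtains x where "\<And>k. k < rank (Suc i) \<Longrightarrow> x k \<in> poly_ring n" "v = vec (rank i) (res_d i x)"
proof -
  obtain u where u: "u \<in> free_module n (rank (Suc i))" "v = D i *\<^sub>v u"
    using assms D_carrier[of i] by (auto simp: map_image_def)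
  then have "u = vec (rank (Suc i)) (\<lambda>k. u $ k)"
    by (auto simp: free_module_def)
  then have "v = vec (rank i) (res_d i (\<lambda>k. u $ k))"
    using u(2) mult_vec by metis
  then show ?thesis
    using that[of "\<lambda>k. u $ k"] u(1) by (auto simp: free_module_def)
qed

lemma res_d_exact:
  assumes y: "\<And>k. k < rank (Suc i) \<Longrightarrow> y k \<in> forms n (c - S (Suc i) ! k)"
    and ker: "\<And>r. r < rank i \<Longrightarrow> res_d i y r = 0"
  shows "\<exists>x. (\<forall>k<rank (Suc (Suc i)). x k \<in> forms n (c - S (Suc (Suc i)) ! k)) \<and>
    (\<forall>k<rank (Suc i). res_d (Suc i) x k = y k)"
proof -
  have "vec (rank i) (res_d i y) = 0\<^sub>v (rank i)"
    using ker by (intro eq_vecI) auto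
  then have "vec (rank (Suc i)) y \<in> map_kernel n (D i)"
    using y D_carrier[of i]
    by (auto simp: map_kernel_def mat_kernel_def free_module_def mult_vec dest: forms_poly_ring)
  then obtain x where x: "\<And>k. k < rank (Suc (Suc i)) \<Longrightarrow> x k \<in> poly_ring n"
      "vec (rank (Suc i)) y = vec (rank (Suc i)) (res_d (Suc i) x)"
    using exact free_module_coefficients by metis
  have eq: "res_d (Suc i) x k = y k" if "k < rank (Suc i)" for k
    using x(2) that by (metis index_vec)
  then have "res_d (Suc i) x k \<in> forms n (c - S (Suc i) ! k)" if "k < rank (Suc i)" for k
    using y that by simp
  from res_d_homogeneous[OF x(1) this] show ?thesis
    using eq by simp
qed

lemma res_d_0_in_I:
  assumes "\<And>k. k < rank 1 \<Longrightarrow> x k \<in> poly_ring n"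
  shows "res_d 0 x 0 \<in> I"
proof -
  have "vec (rank 1) x \<in> free_module n (dim_col (D 0))"
    using assms D_carrier[of 0] by (auto simp: free_module_def)
  then have "(D 0 *\<^sub>v vec (rank 1) x) $ 0 \<in> I"
    using image_D_0 unfolding map_image_def by blast
  then show ?thesis
    using mult_vec_index[of 0 0 x] by (simp add: S_0)
qed

lemma res_d_0_onto_I:
  assumes "f \<in> I" "f \<in> forms n c"
  shows "\<exists>x. (\<forall>k<rank 1. x k \<in> forms n (c - S 1 ! k)) \<and> res_d 0 x 0 = f"
proof -
  obtain v where v: "v \<in> map_image n (D 0)" "f = v $ 0"
    using assms(1) image_D_0 by blast
  then obtain x where x: "\<And>k. k < rank (Suc 0) \<Longrightarrow> x k \<in> poly_ring n" "v = vec (rank 0) (res_d 0 x)"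
    using free_module_coefficients by blast
  then have f: "res_d 0 x 0 = f"
    using v by (simp add: S_0)
  then have "res_d 0 x r \<in> forms n (c - S 0 ! r)" if "r < rank 0" for r
    using assms(2) that by (simp add: S_0)
  from res_d_homogeneous[OF x(1) this] show ?thesis
    using f by (simp add: S_0)
qed

text \<open>The degree \<open>d\<close> part of \<open>F\<^sub>i \<otimes> \<Lambda>\<^sup>q\<close>, where each exterior generator has degree \<open>1\<close>. The first index of \<open>z\<close> is the
  exterior monomial, the second one the basis vector of \<open>F\<^sub>i\<close>.\<close>

definition chain :: "int \<Rightarrow> nat \<Rightarrow> nat \<Rightarrow> (nat set \<Rightarrow> nat \<Rightarrow> 'k mpoly) \<Rightarrow> bool" where
  "chain d i q z \<longleftrightarrow>
     (\<forall>A k. A \<subseteq> {1..n} \<longrightarrow> card A = q \<longrightarrow> k < rank i \<longrightarrow> z A k \<in> forms n (d - int q - S i ! k))"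

lemma chain_koszul_d:
  assumes "chain d i (Suc q) z" "A \<subseteq> {1..n}" "card A = q" "k < rank i"
  shows "koszul_d n (\<lambda>B. z B k) A \<in> forms n (d - int q - S i ! k)"
proof -
  have "finite A"
    using assms finite_subset by blast
  then have "z (insert v A) k \<in> forms n (d - int (Suc q) - S i ! k)" if "v \<in> {1..n} - A" for v
    using assms that unfolding chain_def by auto
  then show ?thesis
    using koszul_d_forms[of n A "\<lambda>B. z B k" "d - int (Suc q) - S i ! k"] by (simp add: algebra_simps)
qed

lemma chain_res_d:
  assumes "chain d (Suc i) q z" "A \<subseteq> {1..n}" "card A = q" "r < rank i"
  shows "res_d i (z A) r \<in> forms n (d - int q - S i ! r)"
  using assms unfolding chain_def by (intro res_d_forms) auto

text \<open>A step of the staircase: \<open>z\<close> can be continued (its image under the differential of \<open>F\<close> is a Koszul boundary), it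
  comes from the previous step (its Koszul differential is an image under the differential of \<open>F\<close>), and it is not a
  sum of boundaries for the two differentials.\<close>

definition survives :: "int \<Rightarrow> nat \<Rightarrow> nat \<Rightarrow> (nat set \<Rightarrow> nat \<Rightarrow> 'k mpoly) \<Rightarrow> bool" where
  "survives d i q z \<longleftrightarrow> chain d i q z \<and>
     (\<forall>h. i = Suc h \<longrightarrow> (\<exists>y. chain d h (Suc q) y \<and>
        (\<forall>A r. A \<subseteq> {1..n} \<longrightarrow> card A = q \<longrightarrow> r < rank h \<longrightarrow> koszul_d n (\<lambda>B. y B r) A = res_d h (z A) r))) \<and>
     (\<forall>p. q = Suc p \<longrightarrow> (\<exists>y. chain d (Suc i) p y \<and>
        (\<forall>A k. A \<subseteq> {1..n} \<longrightarrow> card A = p \<longrightarrow> k < rank i \<longrightarrow> koszul_d n (\<lambda>B. z B k) A = res_d i (y A) k))) \<and>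
     (\<nexists>u w. chain d i (Suc q) u \<and> chain d (Suc i) q w \<and>
        (\<forall>A k. A \<subseteq> {1..n} \<longrightarrow> card A = q \<longrightarrow> k < rank i \<longrightarrow>
           z A k = koszul_d n (\<lambda>B. u B k) A + res_d i (w A) k))"

lemma koszul_exact_columns:
  assumes z: "chain d i q z"
    and cycle: "\<And>A k. A \<subseteq> {1..n} \<Longrightarrow> Suc (card A) = q \<Longrightarrow> k < rank i \<Longrightarrow> koszul_d n (\<lambda>B. z B k) A = 0"
    and q0: "\<And>k. q = 0 \<Longrightarrow> k < rank i \<Longrightarrow> lookup (z {} k) 0 = 0"
  shows "\<exists>w. chain d i (Suc q) w \<and>
    (\<forall>A k. A \<subseteq> {1..n} \<longrightarrow> card A = q \<longrightarrow> k < rank i \<longrightarrow> koszul_d n (\<lambda>B. w B k) A = z A k)"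
proof -
  have "\<exists>w. (\<forall>A. A \<subseteq> {1..n} \<longrightarrow> card A = Suc q \<longrightarrow> w A \<in> forms n (d - S i ! k - int (Suc q))) \<and>
      (\<forall>A. A \<subseteq> {1..n} \<longrightarrow> card A = q \<longrightarrow> koszul_d n w A = z A k)" if k: "k < rank i" for k
  proof -
    have "z A k \<in> forms n (d - S i ! k - int q)" if "A \<subseteq> {1..n}" "card A = q" for A
      using z k that unfolding chain_def by (simp add: algebra_simps)
    then show ?thesis
      using cycle[OF _ _ k] q0[OF _ k] by (rule koszul_exact)
  qed
  then obtain u where "\<forall>k<rank i.
      (\<forall>A. A \<subseteq> {1..n} \<longrightarrow> card A = Suc q \<longrightarrow> u k A \<in> forms n (d - S i ! k - int (Suc q))) \<and>
      (\<forall>A. A \<subseteq> {1..n} \<longrightarrow> card A = q \<longrightarrow> koszul_d n (u k) A = z A k)"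
    by metis
  then have u:
    "\<And>k A. k < rank i \<Longrightarrow> A \<subseteq> {1..n} \<Longrightarrow> card A = Suc q \<Longrightarrow> u k A \<in> forms n (d - S i ! k - int (Suc q))"
    "\<And>k A. k < rank i \<Longrightarrow> A \<subseteq> {1..n} \<Longrightarrow> card A = q \<Longrightarrow> koszul_d n (u k) A = z A k"
    by blast+
  show ?thesis
  proof (intro exI conjI allI impI)
    show "chain d i (Suc q) (\<lambda>A k. u k A)"
      using u(1) unfolding chain_def by (simp add: algebra_simps)
    show "koszul_d n (\<lambda>B. u k B) A = z A k" if "A \<subseteq> {1..n}" "card A = q" "k < rank i" for A k
      using u(2) that by simp
  qed
qed

text \<open>The next element \<open>z'\<close> is a Koszul preimage of the image of \<open>z\<close> in \<open>F\<close>. It can be continued because the Koszul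
  complex is exact in positive degrees. If \<open>z'\<close> were a sum of boundaries, with \<open>w\<close> the part in \<open>F\<^bsub>i+1\<^esub>\<close>, then
  \<open>z\<close> minus the Koszul differential of \<open>w\<close> would be a cycle of \<open>F\<close>, hence a boundary, and \<open>z\<close> itself would be a sum of
  boundaries.\<close>

lemma survives_step:
  assumes "survives d (Suc i) q z"
  shows "\<exists>z'. survives d i (Suc q) z'"
proof -
  note s = assms[unfolded survives_def]
  have z: "chain d (Suc i) q z"
    using s by (rule conjunct1)
  have no: "\<nexists>u w. chain d (Suc i) (Suc q) u \<and> chain d (Suc (Suc i)) q w \<and>
      (\<forall>A k. A \<subseteq> {1..n} \<longrightarrow> card A = q \<longrightarrow> k < rank (Suc i) \<longrightarrow>
         z A k = koszul_d n (\<lambda>B. u B k) A + res_d (Suc i) (w A) k)"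
    using s[THEN conjunct2, THEN conjunct2, THEN conjunct2] .
  obtain z' where z': "chain d i (Suc q) z'"
    "\<And>A r. A \<subseteq> {1..n} \<Longrightarrow> card A = q \<Longrightarrow> r < rank i \<Longrightarrow> koszul_d n (\<lambda>B. z' B r) A = res_d i (z A) r"
    using s[THEN conjunct2, THEN conjunct1, THEN spec, THEN mp, OF refl] by blast
  have down: "\<exists>y. chain d h (Suc (Suc q)) y \<and> (\<forall>A r. A \<subseteq> {1..n} \<longrightarrow> card A = Suc q \<longrightarrow> r < rank h \<longrightarrow>
      koszul_d n (\<lambda>B. y B r) A = res_d h (z' A) r)" if h: "i = Suc h" for h
  proof -
    have "chain d h (Suc q) (\<lambda>A. res_d h (z' A))"
      using chain_res_d z'(1) h unfolding chain_def[of d h "Suc q" "\<lambda>A. res_d h (z' A)"] by blast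
    moreover have "koszul_d n (\<lambda>B. res_d h (z' B) r) A = 0"
      if A: "A \<subseteq> {1..n}" "Suc (card A) = Suc q" and r: "r < rank h" for A r
    proof -
      have "koszul_d n (\<lambda>B. res_d h (z' B) r) A = res_d h (\<lambda>k. koszul_d n (\<lambda>B. z' B k) A) r"
        by (simp add: res_d_koszul_d)
      also have "\<dots> = res_d h (res_d i (z A)) r"
        using z'(2) A h by (intro res_d_cong) auto
      also have "\<dots> = 0"
        using z A r h unfolding chain_def by (auto intro!: res_d_res_d dest: forms_poly_ring)
      finally show ?thesis .
    qed
    ultimately show ?thesis
      by (rule koszul_exact_columns) simp_all
  qed
  have cycle: "\<exists>y. chain d (Suc i) p y \<and> (\<forall>A k. A \<subseteq> {1..n} \<longrightarrow> card A = p \<longrightarrow> k < rank i \<longrightarrow>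
      koszul_d n (\<lambda>B. z' B k) A = res_d i (y A) k)" if "Suc q = Suc p" for p
    using that z z'(2) by auto
  have "\<not> (chain d i (Suc (Suc q)) u \<and> chain d (Suc i) (Suc q) w \<and>
      (\<forall>A k. A \<subseteq> {1..n} \<longrightarrow> card A = Suc q \<longrightarrow> k < rank i \<longrightarrow>
         z' A k = koszul_d n (\<lambda>B. u B k) A + res_d i (w A) k))" for u w
  proof
    assume uw: "chain d i (Suc (Suc q)) u \<and> chain d (Suc i) (Suc q) w \<and>
      (\<forall>A k. A \<subseteq> {1..n} \<longrightarrow> card A = Suc q \<longrightarrow> k < rank i \<longrightarrow>
         z' A k = koszul_d n (\<lambda>B. u B k) A + res_d i (w A) k)"
    have "\<exists>x. (\<forall>k<rank (Suc (Suc i)). x k \<in> forms n (d - int q - S (Suc (Suc i)) ! k)) \<and>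
        (\<forall>k<rank (Suc i). res_d (Suc i) x k = z A k - koszul_d n (\<lambda>B. w B k) A)"
      if A: "A \<subseteq> {1..n}" "card A = q" for A
    proof -
      have "z A k - koszul_d n (\<lambda>B. w B k) A \<in> forms n (d - int q - S (Suc i) ! k)" if "k < rank (Suc i)" for k
      proof (rule forms_diff)
        show "z A k \<in> forms n (d - int q - S (Suc i) ! k)"
          using z A that unfolding chain_def by blast
        show "koszul_d n (\<lambda>B. w B k) A \<in> forms n (d - int q - S (Suc i) ! k)"
          using uw A that by (intro chain_koszul_d) blast+
      qed
      moreover have "res_d i (\<lambda>k. z A k - koszul_d n (\<lambda>B. w B k) A) r = 0" if r: "r < rank i" for r
      proof -
        have fin: "finite A"
          using A finite_subset by blast
        have "res_d i (z A) r = koszul_d n (\<lambda>B. z' B r) A"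
          using z'(2) A r by simp
        also have "\<dots> = koszul_d n (\<lambda>B. koszul_d n (\<lambda>B. u B r) B + res_d i (w B) r) A"
          unfolding koszul_d_def[of n _ A]
        proof (intro sum.cong refl)
          fix v
          assume "v \<in> {1..n} - A"
          then have "z' (insert v A) r = koszul_d n (\<lambda>B. u B r) (insert v A) + res_d i (w (insert v A)) r"
            using uw A r fin by auto
          then show "koszul_sign v A * (Var v * z' (insert v A) r) = koszul_sign v A *
              (Var v * (koszul_d n (\<lambda>B. u B r) (insert v A) + res_d i (w (insert v A)) r))"
            by simp
        qed
        also have "\<dots> = koszul_d n (koszul_d n (\<lambda>B. u B r)) A + koszul_d n (\<lambda>B. res_d i (w B) r) A"
          by (simp add: koszul_d_def[of n _ A] distrib_left sum.distrib)
        also have "\<dots> = res_d i (\<lambda>k. koszul_d n (\<lambda>B. w B k) A) r"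
          using koszul_d_koszul_d[OF fin] by (simp add: res_d_koszul_d)
        finally show ?thesis
          by (simp add: res_d_diff)
      qed
      ultimately show ?thesis
        by (rule res_d_exact)
    qed
    then obtain x where "\<forall>A. A \<subseteq> {1..n} \<longrightarrow> card A = q \<longrightarrow>
        (\<forall>k<rank (Suc (Suc i)). x A k \<in> forms n (d - int q - S (Suc (Suc i)) ! k)) \<and>
        (\<forall>k<rank (Suc i). res_d (Suc i) (x A) k = z A k - koszul_d n (\<lambda>B. w B k) A)"
      by metis
    then have x:
      "\<And>A k. A \<subseteq> {1..n} \<Longrightarrow> card A = q \<Longrightarrow> k < rank (Suc (Suc i)) \<Longrightarrow>
        x A k \<in> forms n (d - int q - S (Suc (Suc i)) ! k)"
      "\<And>A k. A \<subseteq> {1..n} \<Longrightarrow> card A = q \<Longrightarrow> k < rank (Suc i) \<Longrightarrow>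
        res_d (Suc i) (x A) k = z A k - koszul_d n (\<lambda>B. w B k) A"
      by blast+
    have "chain d (Suc (Suc i)) q x"
      using x(1) unfolding chain_def by blast
    moreover have "z A k = koszul_d n (\<lambda>B. w B k) A + res_d (Suc i) (x A) k"
      if "A \<subseteq> {1..n}" "card A = q" "k < rank (Suc i)" for A k
      using x(2)[OF that] by simp
    ultimately show False
      using no uw by blast
  qed
  then have "\<nexists>u w. chain d i (Suc (Suc q)) u \<and> chain d (Suc i) (Suc q) w \<and>
      (\<forall>A k. A \<subseteq> {1..n} \<longrightarrow> card A = Suc q \<longrightarrow> k < rank i \<longrightarrow>
         z' A k = koszul_d n (\<lambda>B. u B k) A + res_d i (w A) k)"
    by (intro notI) (elim exE, rule notE)
  then have "survives d i (Suc q) z'"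
    unfolding survives_def by (intro conjI allI impI z'(1) down cycle)
  then show ?thesis
    by (intro exI)
qed

lemma survives_transport: "survives d i q z \<Longrightarrow> \<exists>z'. survives d 0 (i + q) z'"
proof (induction i arbitrary: q z)
  case (Suc i)
  then show ?case
    using survives_step by (metis add_Suc_shift)
qed auto

text \<open>By minimality the image of a basis vector has no constant terms, so it is a Koszul boundary. The basis vector
  is not a sum of boundaries because its own constant term is \<open>1\<close>.\<close>

lemma generator_survives:
  assumes "k0 < rank i" "S i ! k0 = d"
  shows "\<exists>z. survives d i 0 z"
proof -
  define z :: "nat set \<Rightarrow> nat \<Rightarrow> 'k mpoly" where "z = (\<lambda>A k. if k = k0 then 1 else 0)"
  have one: "(1 :: 'k mpoly) \<in> forms n 0"
    by (auto simp: forms_def poly_ring_def mono_deg_def)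
  have ch: "chain d i 0 z"
    using assms one forms_zero by (auto simp: chain_def z_def)
  have down: "\<exists>y. chain d h (Suc 0) y \<and> (\<forall>A r. A \<subseteq> {1..n} \<longrightarrow> card A = 0 \<longrightarrow> r < rank h \<longrightarrow>
      koszul_d n (\<lambda>B. y B r) A = res_d h (z A) r)" if h: "i = Suc h" for h
  proof -
    have "chain d h 0 (\<lambda>A. res_d h (z A))"
      using chain_res_d ch h unfolding chain_def[of d h 0 "\<lambda>A. res_d h (z A)"] by blast
    then show ?thesis
      by (rule koszul_exact_columns) (simp_all add: res_d_minimal)
  qed
  have "\<not> (\<forall>A k. A \<subseteq> {1..n} \<longrightarrow> card A = 0 \<longrightarrow> k < rank i \<longrightarrow>
         z A k = koszul_d n (\<lambda>B. u B k) A + res_d i (w A) k)" for u w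
  proof
    assume "\<forall>A k. A \<subseteq> {1..n} \<longrightarrow> card A = 0 \<longrightarrow> k < rank i \<longrightarrow>
         z A k = koszul_d n (\<lambda>B. u B k) A + res_d i (w A) k"
    then have "z {} k0 = koszul_d n (\<lambda>B. u B k0) {} + res_d i (w {}) k0"
      using assms(1) by simp
    then have "lookup (z {} k0) 0 = 0"
      using assms(1) by (simp add: lookup_add lookup_koszul_d_zero res_d_minimal)
    then show False
      by (simp add: z_def)
  qed
  then have "\<nexists>u w. chain d i (Suc 0) u \<and> chain d (Suc i) 0 w \<and>
      (\<forall>A k. A \<subseteq> {1..n} \<longrightarrow> card A = 0 \<longrightarrow> k < rank i \<longrightarrow>
         z A k = koszul_d n (\<lambda>B. u B k) A + res_d i (w A) k)"
    by (intro notI) (elim exE conjE, rule notE)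
  then have "survives d i 0 z"
    unfolding survives_def by (intro conjI allI impI ch down) simp_all
  then show ?thesis
    by (intro exI)
qed

text \<open>At the end of the staircase there is a Koszul chain over \<open>F\<^sub>0 = R\<close> that is a cycle modulo \<open>I\<close> but not a boundary
  modulo \<open>I\<close>. If all strands of its degree were acyclic, it would be a boundary.\<close>

theorem betti_strand:
  assumes I: "I = {f \<in> poly_ring n. keys f \<subseteq> M}" and "j \<in> set (S i)"
  shows "\<exists>e. keys e \<subseteq> {1..n} \<and> int (mono_deg e) = j \<and>
    \<not> acyclic_at TYPE('k) (keys e) {B. B \<subseteq> keys e \<and> e - sqfree B \<notin> M} i"
proof (rule ccontr)
  assume "\<not> ?thesis"
  then have acyclic: "acyclic_at TYPE('k) (keys e) {B. B \<subseteq> keys e \<and> e - sqfree B \<notin> M} i"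
    if "keys e \<subseteq> {1..n}" "int (mono_deg e) = j" for e
    using that by blast
  obtain k0 where "k0 < rank i" "S i ! k0 = j"
    using assms(2) by (metis in_set_conv_nth)
  then obtain z where z: "survives j 0 i z"
    using generator_survives survives_transport by (metis add_0_right)
  have zf: "z A 0 \<in> forms n (j - int i)" if "A \<subseteq> {1..n}" "card A = i" for A
    using z that unfolding survives_def chain_def by (auto simp: S_0)
  have "lookup (koszul_d n (\<lambda>B. z B 0) A) m = 0"
    if A: "A \<subseteq> {1..n}" "Suc (card A) = i" and m: "m \<notin> M" for A m
  proof -
    obtain y where "chain j (Suc 0) (card A) y" "koszul_d n (\<lambda>B. z B 0) A = res_d 0 (y A) 0"
      using z A unfolding survives_def by (metis S_0 length_Cons zero_less_Suc)
    then have "koszul_d n (\<lambda>B. z B 0) A \<in> I"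
      using A res_d_0_in_I[of "y A"] unfolding chain_def by (auto dest: forms_poly_ring)
    then show ?thesis
      using I m by (auto simp: in_keys_iff)
  qed
  moreover have "acyclic_at TYPE('k) (keys (m + sqfree A))
      {B. B \<subseteq> keys (m + sqfree A) \<and> m + sqfree A - sqfree B \<notin> M} i"
    if A: "A \<subseteq> {1..n}" "card A = i" "m \<in> keys (z A 0)" for A m
  proof (rule acyclic)
    have fin: "finite A"
      using A finite_subset by blast
    show "keys (m + sqfree A) \<subseteq> {1..n}"
      using zf[OF A(1,2)] A fin by (auto simp: keys_plus_nat keys_sqfree forms_def poly_ring_def)
    show "int (mono_deg (m + sqfree A)) = j"
      using zf[OF A(1,2)] A fin by (auto simp: mono_deg_add mono_deg_sqfree forms_def)
  qed
  ultimately have "\<exists>w. (\<forall>A. A \<subseteq> {1..n} \<longrightarrow> card A = Suc i \<longrightarrow> w A \<in> forms n (j - int (Suc i))) \<and>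
      (\<forall>A m. A \<subseteq> {1..n} \<longrightarrow> card A = i \<longrightarrow> m \<notin> M \<longrightarrow> lookup (koszul_d n w A) m = lookup (z A 0) m)"
    using zf by (intro koszul_exact_mod_monomials) blast+
  then obtain w where w:
      "\<And>A. A \<subseteq> {1..n} \<Longrightarrow> card A = Suc i \<Longrightarrow> w A \<in> forms n (j - int (Suc i))"
      "\<And>A m. A \<subseteq> {1..n} \<Longrightarrow> card A = i \<Longrightarrow> m \<notin> M \<Longrightarrow> lookup (koszul_d n w A) m = lookup (z A 0) m"
    by blast
  have u: "chain j 0 (Suc i) (\<lambda>A k. w A)"
    using w(1) unfolding chain_def by (simp add: S_0)
  have "\<exists>x. (\<forall>k<rank 1. x k \<in> forms n (j - int i - S 1 ! k)) \<and> res_d 0 x 0 = z A 0 - koszul_d n w A"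
    if A: "A \<subseteq> {1..n}" "card A = i" for A
  proof -
    have f: "z A 0 - koszul_d n w A \<in> forms n (j - int i)"
      using zf[OF A] chain_koszul_d[OF u A] by (auto simp: S_0 intro: forms_diff)
    moreover have "keys (z A 0 - koszul_d n w A) \<subseteq> M"
    proof
      fix m
      assume "m \<in> keys (z A 0 - koszul_d n w A)"
      then have "lookup (koszul_d n w A) m \<noteq> lookup (z A 0) m"
        by (auto simp: in_keys_iff lookup_minus)
      then show "m \<in> M"
        using w(2)[OF A] by blast
    qed
    then have "z A 0 - koszul_d n w A \<in> I"
      using forms_poly_ring[OF f] by (simp add: I)
    ultimately show ?thesis
      by (intro res_d_0_onto_I)
  qed
  then obtain x where "\<forall>A. A \<subseteq> {1..n} \<longrightarrow> card A = i \<longrightarrow>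
      (\<forall>k<rank 1. x A k \<in> forms n (j - int i - S 1 ! k)) \<and> res_d 0 (x A) 0 = z A 0 - koszul_d n w A"
    by metis
  then have x:
    "\<And>A k. A \<subseteq> {1..n} \<Longrightarrow> card A = i \<Longrightarrow> k < rank 1 \<Longrightarrow> x A k \<in> forms n (j - int i - S 1 ! k)"
    "\<And>A. A \<subseteq> {1..n} \<Longrightarrow> card A = i \<Longrightarrow> res_d 0 (x A) 0 = z A 0 - koszul_d n w A"
    by blast+
  have "chain j (Suc 0) i x"
    using x(1) unfolding chain_def by simp
  moreover have "z A k = koszul_d n w A + res_d 0 (x A) k" if "A \<subseteq> {1..n}" "card A = i" "k < rank 0" for A k
    using x(2) that by (simp add: S_0)
  ultimately show False
    using z u unfolding survives_def by blast
qed

end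

section \<open>The path ideal of a cycle as a monomial ideal\<close>

lemma prod_Var: "finite A \<Longrightarrow> (\<Prod>v\<in>A. Var v) = (Poly_Mapping.single (sqfree A) 1 :: 'k::field mpoly)"
  by (induction A rule: finite_induct) (auto simp: Var_def sqfree_def mult_single)

lemma sum_single_keys: "(\<Sum>m\<in>keys f. Poly_Mapping.single m (lookup f m)) = f"
  by (rule poly_mapping_eqI) (auto simp: lookup_sum lookup_single when_def in_keys_iff)

lemma poly_ring_sum: "(\<And>x. x \<in> X \<Longrightarrow> f x \<in> poly_ring n) \<Longrightarrow> sum f X \<in> poly_ring n"
  by (induction X rule: infinite_finite_induct) (auto intro: poly_ring_zero poly_ring_add)

text \<open>To write a polynomial whose terms are all divisible by generators as a combination of the generators,
  a generator dividing the term is chosen for each term, and the terms are collected by generator.\<close>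

lemma squarefree_monomial_ideal:
  assumes \<A>: "\<And>A. A \<in> \<A> \<Longrightarrow> A \<subseteq> {1..n}"
  shows "ideal_generated n ((\<lambda>A. Poly_Mapping.single (sqfree A) 1) ` \<A>) =
    {f :: 'k::field mpoly. f \<in> poly_ring n \<and> keys f \<subseteq> {m. \<exists>A\<in>\<A>. A \<subseteq> keys m}}"
proof (intro equalityI subsetI)
  fix f :: "'k mpoly"
  assume "f \<in> ideal_generated n ((\<lambda>A. Poly_Mapping.single (sqfree A) 1) ` \<A>)"
  then obtain c G where G: "f = (\<Sum>g\<in>G. c g * g)" "G \<subseteq> (\<lambda>A. Poly_Mapping.single (sqfree A) 1) ` \<A>"
      "\<And>g. g \<in> G \<Longrightarrow> c g \<in> poly_ring n"
    unfolding ideal_generated_def by blast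
  have gen: "\<exists>A\<in>\<A>. finite A \<and> A \<subseteq> {1..n} \<and> g = Poly_Mapping.single (sqfree A) 1" if g: "g \<in> G" for g
  proof -
    obtain A where A: "A \<in> \<A>" "g = Poly_Mapping.single (sqfree A) 1"
      using g G(2) by blast
    then show ?thesis
      using \<A>[OF A(1)] finite_subset[OF \<A>[OF A(1)]] by blast
  qed
  have "g \<in> poly_ring n" if "g \<in> G" for g
    using gen[OF that] by (auto simp: poly_ring_def keys_sqfree)
  then have "f \<in> poly_ring n"
    unfolding G(1) by (intro poly_ring_sum poly_ring_mult G(3))
  moreover have "\<exists>A\<in>\<A>. A \<subseteq> keys m" if "m \<in> keys f" for m
  proof -
    have "lookup f m \<noteq> 0"
      using that by (simp add: in_keys_iff)
    then have "\<exists>g\<in>G. lookup (c g * g) m \<noteq> 0"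
      unfolding G(1) lookup_sum by (meson sum.not_neutral_contains_not_neutral)
    then obtain g where g: "g \<in> G" "m \<in> keys (c g * g)"
      by (auto simp: in_keys_iff)
    from gen[OF g(1)] obtain A where A: "A \<in> \<A>" "finite A" "g = Poly_Mapping.single (sqfree A) 1"
      by blast
    obtain a b where "m = a + b" "b \<in> keys g"
      using g(2) by (rule keys_mult_cases)
    then have "A \<subseteq> keys m"
      using A by (auto simp: keys_plus_nat keys_sqfree)
    then show ?thesis
      using A(1) by blast
  qed
  ultimately show "f \<in> {f. f \<in> poly_ring n \<and> keys f \<subseteq> {m. \<exists>A\<in>\<A>. A \<subseteq> keys m}}"
    by blast
next
  fix f :: "'k mpoly"
  assume f: "f \<in> {f. f \<in> poly_ring n \<and> keys f \<subseteq> {m. \<exists>A\<in>\<A>. A \<subseteq> keys m}}"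
  then have "\<forall>m\<in>keys f. \<exists>A. A \<in> \<A> \<and> A \<subseteq> keys m"
    by blast
  then obtain p where p: "\<forall>m\<in>keys f. p m \<in> \<A> \<and> p m \<subseteq> keys m"
    by metis
  define gen :: "(nat \<Rightarrow>\<^sub>0 nat) \<Rightarrow> 'k mpoly" where "gen = (\<lambda>m. Poly_Mapping.single (sqfree (p m)) 1)"
  define c where "c = (\<lambda>g. \<Sum>m\<in>{m \<in> keys f. gen m = g}.
    Poly_Mapping.single (m - sqfree (p m)) (lookup f m))"
  have "f = (\<Sum>m\<in>keys f. Poly_Mapping.single (m - sqfree (p m)) (lookup f m) * gen m)"
    using p sqfree_diff_add by (simp add: gen_def mult_single sum_single_keys)
  also have "\<dots> = (\<Sum>g\<in>gen ` keys f. c g * g)"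
    by (subst sum.image_gen[of _ _ gen]) (auto simp: c_def sum_distrib_right intro!: sum.cong)
  finally have "f = (\<Sum>g\<in>gen ` keys f. c g * g)" .
  moreover have "gen ` keys f \<subseteq> (\<lambda>A. Poly_Mapping.single (sqfree A) 1) ` \<A>"
    using p by (auto simp: gen_def)
  moreover have "c g \<in> poly_ring n" for g
    unfolding c_def
  proof (rule poly_ring_sum)
    fix m
    assume "m \<in> {m \<in> keys f. gen m = g}"
    then have "keys m \<subseteq> {1..n}"
      using f by (auto simp: poly_ring_def)
    moreover have "keys (m - sqfree (p m)) \<subseteq> keys m"
      by (auto simp: in_keys_iff lookup_minus)
    ultimately show "Poly_Mapping.single (m - sqfree (p m)) (lookup f m) \<in> poly_ring n"
      by (auto simp: poly_ring_def)
  qed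
  ultimately show "f \<in> ideal_generated n ((\<lambda>A. Poly_Mapping.single (sqfree A) 1) ` \<A>)"
    unfolding ideal_generated_def by (intro CollectI exI[of _ "gen ` keys f"] exI[of _ c]) auto
qed

definition cycle_path :: "nat \<Rightarrow> nat \<Rightarrow> nat \<Rightarrow> nat set" where
  "cycle_path n t i = (\<lambda>k. cyc n (i + k)) ` {..<t}"

lemma cyc_cyc: "a \<ge> 1 \<Longrightarrow> cyc n (cyc n a + k) = cyc n (a + k)"
  by (simp add: cyc_def mod_add_left_eq)

lemma cyc_range: "n \<ge> 1 \<Longrightarrow> cyc n k \<in> {1..n}"
  by (simp add: cyc_def Suc_le_eq)

lemma cyc_inj:
  assumes "i \<ge> 1"
  shows "inj_on (\<lambda>k. cyc n (i + k)) {..<n}"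
proof (rule linorder_inj_onI)
  fix k l
  assume k: "k < l" "k \<in> {..<n}" "l \<in> {..<n}"
  show "cyc n (i + k) \<noteq> cyc n (i + l)"
  proof
    assume "cyc n (i + k) = cyc n (i + l)"
    then have "n dvd (i + l - 1) - (i + k - 1)"
      using assms k by (subst mod_eq_dvd_iff_nat[symmetric]) (auto simp: cyc_def)
    then show False
      using assms k by (auto dest: dvd_imp_le)
  qed
qed auto

lemma path_ideal_cycle_eq:
  assumes "t \<le> n" "n \<ge> 1"
  shows "path_ideal_cycle n t =
    {f :: 'k::field mpoly. f \<in> poly_ring n \<and> keys f \<subseteq> {m. \<exists>i\<in>{1..n}. cycle_path n t i \<subseteq> keys m}}"
proof -
  have "(\<Prod>k<t. Var (cyc n (i + k))) = (Poly_Mapping.single (sqfree (cycle_path n t i)) 1 :: 'k mpoly)"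
    if "i \<in> {1..n}" for i
  proof -
    have "inj_on (\<lambda>k. cyc n (i + k)) {..<t}"
      using that assms by (intro inj_on_subset[OF cyc_inj]) auto
    then show ?thesis
      by (simp add: cycle_path_def prod.reindex flip: prod_Var)
  qed
  then have "(\<lambda>i. \<Prod>k<t. Var (cyc n (i + k))) ` {1..n} =
      (\<lambda>A. Poly_Mapping.single (sqfree A) 1 :: 'k mpoly) ` cycle_path n t ` {1..n}"
    unfolding image_image by (rule image_cong[OF refl])
  moreover have "cycle_path n t i \<subseteq> {1..n}" for i
    using cyc_range[OF assms(2)] by (auto simp: cycle_path_def)
  ultimately show ?thesis
    unfolding path_ideal_cycle_def
    using squarefree_monomial_ideal[of "cycle_path n t ` {1..n}" n] by auto
qed

section \<open>Strands of proper subsets of a cycle\<close>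

text \<open>If \<open>v\<close> has exponent at least 2 in \<open>e\<close>, subtracting \<open>1\<close> at \<open>v\<close> does not change the support. Membership of a
  monomial in \<open>M\<close> depends only on its support, so the strand is a cone over \<open>v\<close>.\<close>

lemma nonacyclic_squarefree:
  assumes \<A>: "M = {m. \<exists>A\<in>\<A>. A \<subseteq> keys m}"
    and na: "\<not> acyclic_at T (keys e) {B. B \<subseteq> keys e \<and> e - sqfree B \<notin> M} i"
  shows "e = sqfree (keys e)"
proof (rule ccontr)
  assume "e \<noteq> sqfree (keys e)"
  then obtain v where "lookup e v \<noteq> lookup (sqfree (keys e)) v"
    by (auto simp: poly_mapping_eq_iff fun_eq_iff)
  then have v: "lookup e v \<ge> 2"
    by (cases "lookup e v = 0") (auto simp: lookup_sqfree in_keys_iff split: if_splits)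
  then have vk: "v \<in> keys e"
    by (simp add: in_keys_iff)
  have "acyclic_at T (keys e) {B. B \<subseteq> keys e \<and> e - sqfree B \<notin> M} i"
  proof (rule acyclic_cone[of _ v])
    fix B
    have "keys (e - sqfree (insert v B)) = keys (e - sqfree B)" if "finite B"
      using v that by (auto simp: in_keys_iff lookup_minus lookup_sqfree split: if_splits)
    then show "insert v B \<in> {B. B \<subseteq> keys e \<and> e - sqfree B \<notin> M} \<longleftrightarrow>
        B \<in> {B. B \<subseteq> keys e \<and> e - sqfree B \<notin> M}"
      using vk finite_subset[of B "keys e"] by (auto simp: \<A>)
  qed (use vk in auto)
  then show False
    using na by blast
qed

text \<open>Counting the vertices from \<open>u\<close> turns the remaining cycle into the line \<open>1, \<dots>, n - 1\<close>. A path of the cycle that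
  avoids \<open>u\<close> cannot wrap around, so it is an interval of this line.\<close>

lemma cut_cycle:
  assumes t: "1 \<le> t" and W: "W \<subseteq> {1..n}" and u: "u \<in> {1..n} - W"
  defines "\<phi> \<equiv> \<lambda>k. cyc n (u + k)"
  obtains X where "X \<subseteq> {1..n - 1}" "inj_on \<phi> X" "\<phi> ` X = W"
    "{B. B \<subseteq> W \<and> \<not> (\<exists>i\<in>{1..n}. cycle_path n t i \<subseteq> W - B)} = path_complex \<phi> t X"
proof -
  have n: "n \<ge> 1" and u1: "u \<ge> 1" "u \<le> n"
    using u by auto
  have inj: "inj_on \<phi> {..<n}"
    unfolding \<phi>_def using u1 by (intro cyc_inj)
  have \<phi>0: "\<phi> 0 = u"
    using u1 by (simp add: \<phi>_def cyc_def)
  have "(u + n - 1) mod n = (u - 1 + n) mod n"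
    using u1 by simp
  also have "\<dots> = u - 1"
    using u1 by (subst mod_add_self2) simp
  finally have \<phi>n: "\<phi> n = u"
    using u1 by (simp only: \<phi>_def cyc_def)
  have surj: "\<phi> ` {..<n} = {1..n}"
  proof (rule card_subset_eq)
    show "\<phi> ` {..<n} \<subseteq> {1..n}"
      using cyc_range[OF n] by (auto simp: \<phi>_def)
  qed (simp_all add: card_image[OF inj])
  define X where "X = {k \<in> {1..n - 1}. \<phi> k \<in> W}"
  have sub: "X \<subseteq> {1..n - 1}"
    by (auto simp: X_def)
  have injX: "inj_on \<phi> X"
    by (rule inj_on_subset[OF inj]) (use n in \<open>auto simp: X_def\<close>)
  have pos: "\<exists>k\<in>{1..n - 1}. i = \<phi> k" if i: "i \<in> {1..n}" "i \<noteq> u" for i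
  proof -
    have "i \<in> \<phi> ` {..<n}"
      using i surj by simp
    then obtain k where k: "k < n" "i = \<phi> k"
      by blast
    then have "k \<noteq> 0"
      using i \<phi>0 by metis
    then show ?thesis
      using k by (intro bexI[of _ k]) auto
  qed
  have img: "\<phi> ` X = W"
  proof
    show "W \<subseteq> \<phi> ` X"
    proof
      fix i
      assume i: "i \<in> W"
      then obtain k where "k \<in> {1..n - 1}" "i = \<phi> k"
        using pos[of i] W u by blast
      then show "i \<in> \<phi> ` X"
        using i by (simp add: X_def)
    qed
  qed (auto simp: X_def)
  have path: "cycle_path n t (\<phi> s) = \<phi> ` {s..<s + t}" for s
  proof -
    have "cycle_path n t (\<phi> s) = (\<lambda>k. \<phi> (s + k)) ` {..<t}"
      unfolding cycle_path_def \<phi>_def using u1 by (simp add: cyc_cyc add.assoc)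
    also have "\<dots> = \<phi> ` (+) s ` {..<t}"
      by (simp add: image_image)
    also have "(+) s ` {..<t} = {s..<s + t}"
      by (simp add: lessThan_atLeast0 add.commute)
    finally show ?thesis .
  qed
  have paths: "(\<exists>i\<in>{1..n}. cycle_path n t i \<subseteq> W - B) \<longleftrightarrow>
      (\<exists>s. {s..<s + t} \<subseteq> X \<and> B \<inter> \<phi> ` {s..<s + t} = {})" for B
  proof
    assume "\<exists>i\<in>{1..n}. cycle_path n t i \<subseteq> W - B"
    then obtain i where i: "i \<in> {1..n}" "cycle_path n t i \<subseteq> W - B"
      by blast
    have "i \<in> cycle_path n t i"
      using i(1) t unfolding cycle_path_def by (intro image_eqI[of _ _ 0]) (auto simp: cyc_def)
    then have "i \<noteq> u"
      using i(2) u by blast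
    then obtain s where s: "s \<in> {1..n - 1}" "i = \<phi> s"
      using pos[OF i(1)] by blast
    then have sB: "\<phi> ` {s..<s + t} \<subseteq> W - B"
      using i path by simp
    have "n \<notin> {s..<s + t}"
    proof
      assume "n \<in> {s..<s + t}"
      then show False
        using sB \<phi>n u by blast
    qed
    then have "{s..<s + t} \<subseteq> {1..n - 1}"
      using s by auto
    then have "{s..<s + t} \<subseteq> X"
      using sB unfolding X_def by blast
    then show "\<exists>s. {s..<s + t} \<subseteq> X \<and> B \<inter> \<phi> ` {s..<s + t} = {}"
      using sB by blast
  next
    assume "\<exists>s. {s..<s + t} \<subseteq> X \<and> B \<inter> \<phi> ` {s..<s + t} = {}"
    then obtain s where s: "{s..<s + t} \<subseteq> X" "B \<inter> \<phi> ` {s..<s + t} = {}"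
      by blast
    then have "\<phi> ` {s..<s + t} \<subseteq> W - B"
      using img by blast
    moreover have "\<phi> s \<in> {1..n}"
      using cyc_range[OF n] by (simp add: \<phi>_def)
    ultimately show "\<exists>i\<in>{1..n}. cycle_path n t i \<subseteq> W - B"
      using path by metis
  qed
  have "{B. B \<subseteq> W \<and> \<not> (\<exists>i\<in>{1..n}. cycle_path n t i \<subseteq> W - B)} = path_complex \<phi> t X"
    unfolding paths path_complex_def img by blast
  then show ?thesis
    by (rule that[OF sub injX img])
qed

section \<open>The bounds on the graded Betti numbers\<close>

theorem theorem5p4:
  fixes n t p d i :: nat and j :: int
    and S :: "nat \<Rightarrow> int list" and D :: "nat \<Rightarrow> 'k::field mpoly mat"
  assumes "2 \<le> t" and "t \<le> n"
    and "n = (t + 1) * p + d" and "d < t + 1"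
    and "minimal_graded_free_resolution n (path_ideal_cycle n t :: 'k mpoly set) S D"
    and "int i \<le> j" and "j < int n"
    and "graded_betti S i j \<noteq> 0"
  shows "j \<le> int i * int t
    \<and> j - int i \<le> (int t - 1) * int p
    \<and> (d = 0 \<longrightarrow> i < 2 * p)
    \<and> (d \<noteq> 0 \<longrightarrow> i \<le> 2 * p + 1)"
proof -
  interpret minimal_resolution n "path_ideal_cycle n t" S D
    using assms(5) by unfold_locales
  define M :: "(nat \<Rightarrow>\<^sub>0 nat) set" where "M = {m. \<exists>A\<in>cycle_path n t ` {1..n}. A \<subseteq> keys m}"
  have I: "path_ideal_cycle n t = {f \<in> poly_ring n :: 'k mpoly set. keys f \<subseteq> M}"
    using path_ideal_cycle_eq[of t n] assms(1,2) by (simp add: M_def)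
  have "j \<in> set (S i)"
    using assms(8) by (metis count_notin graded_betti_def)
  then obtain e where e: "keys e \<subseteq> {1..n}" "int (mono_deg e) = j"
      "\<not> acyclic_at TYPE('k) (keys e) {B. B \<subseteq> keys e \<and> e - sqfree B \<notin> M} i"
    using betti_strand[OF I] by blast
  define W where "W = keys e"
  have sqf: "e = sqfree W"
    unfolding W_def using M_def e(3) by (rule nonacyclic_squarefree)
  have finW: "finite W"
    by (simp add: W_def)
  have card: "int (card W) = j"
    using e(2) sqf finW mono_deg_sqfree by metis
  have U: "{B. B \<subseteq> keys e \<and> e - sqfree B \<notin> M} =
      {B. B \<subseteq> W \<and> \<not> (\<exists>i\<in>{1..n}. cycle_path n t i \<subseteq> W - B)}"
  proof (intro Collect_cong conj_cong)
    show "B \<subseteq> keys e \<longleftrightarrow> B \<subseteq> W" for B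
      by (simp add: W_def)
    fix B
    assume "B \<subseteq> W"
    then have "keys (e - sqfree B) = W - B"
      using finW finite_subset[of B W]
      by (subst sqf) (auto simp: in_keys_iff lookup_minus lookup_sqfree split: if_splits)
    then show "e - sqfree B \<notin> M \<longleftrightarrow> \<not> (\<exists>i\<in>{1..n}. cycle_path n t i \<subseteq> W - B)"
      by (simp add: M_def)
  qed
  have t1: "1 \<le> t"
    using assms(1) by simp
  have WN: "W \<subseteq> {1..n}"
    using e(1) by (simp add: W_def)
  have "W \<noteq> {1..n}"
    using card assms(7) by auto
  then obtain u where u: "u \<in> {1..n} - W"
    using WN by blast
  obtain X where X: "X \<subseteq> {1..n - 1}" "inj_on (\<lambda>k. cyc n (u + k)) X" "(\<lambda>k. cyc n (u + k)) ` X = W"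
    "{B. B \<subseteq> W \<and> \<not> (\<exists>i\<in>{1..n}. cycle_path n t i \<subseteq> W - B)} =
      path_complex (\<lambda>k. cyc n (u + k)) t X"
    using cut_cycle[OF t1 WN u] by blast
  have "\<not> acyclic_at TYPE('k) ((\<lambda>k. cyc n (u + k)) ` X) (path_complex (\<lambda>k. cyc n (u + k)) t X) i"
    using e(3) unfolding U X(4) unfolding X(3) W_def .
  then obtain b a where ba: "a \<le> b" "i = b + a" "card X = b * t + a" "b * (t + 1) \<le> n - 1 + 1"
    using line_nonacyclic_bounds[OF X(2,1) t1] by blast
  have j: "j = int b * int t + int a"
    using card ba(3) card_image[OF X(2)] X(3) by simp
  have bn: "b * (t + 1) \<le> n"
    using ba(4) assms(1,2) by simp
  \<comment> \<open>This is where \<open>d < t + 1\<close> enters: \<open>p\<close> is the integer quotient of \<open>n\<close> by \<open>t + 1\<close>.\<close>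
  have bp: "b \<le> p"
  proof (rule ccontr)
    assume "\<not> b \<le> p"
    then have "(p + 1) * (t + 1) \<le> b * (t + 1)"
      by (intro mult_right_mono) auto
    then show False
      using bn assms(3,4) by (simp add: algebra_simps)
  qed
  have "int a \<le> int a * int t"
    using t1 by (cases "a = 0") auto
  then have 1: "j \<le> int i * int t"
    by (simp add: j ba(2) algebra_simps)
  have "j - int i = int b * (int t - 1)"
    by (simp add: j ba(2) algebra_simps)
  also have "\<dots> \<le> int p * (int t - 1)"
    using bp t1 by (intro mult_right_mono) auto
  finally have 2: "j - int i \<le> (int t - 1) * int p"
    by (simp add: mult.commute)
  have "i \<noteq> 2 * p" if "d = 0"
  proof
    assume "i = 2 * p"
    then have "a = p" "b = p"
      using ba bp by auto
    then have "j = int n"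
      using that assms(3) by (simp add: j algebra_simps)
    then show False
      using assms(7) by simp
  qed
  moreover have "i \<le> 2 * p"
    using ba bp by simp
  ultimately show ?thesis
    using 1 2 by auto
qed

end
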